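(* Let $\Theta=(\theta_1,\theta_2,\theta_3,\theta_4)\in\mathbb{R}^4$ be such that $1,\theta_1,\theta_2,\theta_3,\theta_4$ are linearly independent over $\mathbb{Z}$, and write $\omega=\omega(\Theta)$, $\hat\omega=\hat\omega(\Theta)$, and assume $\hat\omega<1$. Then: 1) if $\mathfrak{i}(\Theta)=1$, then $\omega\ge \hat\omega\, G_1(\hat\omega)$; 2) if $\mathfrak{i}(\Theta)=2$, then $\omega\ge \hat\omega\, G_2(\hat\omega)$; 3) if $\mathfrak{i}(\Theta)=3$, then $\omega\ge \hat\omega\, G_3(\hat\omega)$.
   Context: For $x\in\mathbb{R}$, $\|x\|$ is the distance to the nearest integer. Let $\psi_\Theta(t)=\min_{q\in\mathbb{Z}_+,\,q\le t}\max_{1\le j\le4}\|q\theta_j\|$. Define $\omega(\Theta)=\sup\{\gamma:\liminf_{t\to\infty}t^\gamma\psi_\Theta(t)<\infty\}$ and $\hat\omega(\Theta)=\sup\{\gamma:\limsup_{t\to\infty}t^\gamma\psi_\Theta(t)<\infty\}$; one has $1/4\le\hat\omega\le1$. Best approximations: a positive integer $q$ is a best approximation denominator if $\max_j\|x\theta_j\|>\max_j\|q\theta_j\|$ for all integers $1\le x<q$; enumerate them $q_0<q_1<\cdots$, let $a_{j,\nu}$ be the integer nearest to $q_\nu\theta_j$, and $\mathbf{z}_\nu=(q_\nu,a_{1,\nu},\dots,a_{4,\nu})\in\mathbb{Z}^5$. Index: $\mathfrak{i}(\Theta)$ is the least positive integer $n$ for which there exists a sequence (indexed by $l=1,2,\dots$)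 of index tuples $\nu_l=r_0<r_1<\dots<r_n<r_{n+1}=k_l$ (the $r_i$ depending on $l$) such that: (i) $\nu_l\to\infty$; (ii) for each $0\le i\le n+1$, $\mathbf{z}_{r_i-1},\mathbf{z}_{r_i},\mathbf{z}_{r_i+1}$ are linearly independent; (iii) for each $0\le i\le n$, all consecutive pairs $(\mathbf{z}_{m},\mathbf{z}_{m+1})$ with $r_i\le m\le r_{i+1}-1$ span the same two-dimensional subspace of $\mathbb{R}^5$; (iv) there is a three-dimensional subspace $T_l$ with $T_l=\mathrm{span}(\mathbf{z}_{r_i-1},\mathbf{z}_{r_i},\mathbf{z}_{r_i+1})$ for all $1\le i\le n$; (v) $\mathbf{z}_{\nu_l-1}\notin T_l$ and $\mathbf{z}_{k_l+1}\notin T_l$; (vi) $\mathbf{z}_{\nu_l-1},\mathbf{z}_{r_n-1},\mathbf{z}_{k_l-1},\mathbf{z}_{k_l},\mathbf{z}_{k_l+1}$ are linearly independent. If no such $n$ exists, $\mathfrak{i}(\Theta)=\infty$. Functions: for $w\in[1/4,1)$ put $c=\frac{w}{1-w}$. $G_1(w)$ is the unique positive real root of $x^3-cx^2-cx-c$. For $w\in[1/4,1/2]$, $G_2(w)$ is the unique positive root of $x^4-cx^3-cx^2+c^2x-\frac{w}{(1-w)^2}$; for $w\in[1/2,1)$, $G_2(w)$ is the unique positive root of $x^4-cx^3-cx^2+cx-\frac{w}{(1-w)^2}$. $G_3(w)$ is the unique positive root of $x^5-cx^4-cx^3+c^2x^2-\frac{w}{(1-w)^2}$.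
   Formalization: The polynomial defining G_3(w) has three positive roots for w near 1 (e.g. w = 9/10), so "the unique positive root" is ill-defined there; G_3(w) is taken to be the largest positive root, which agrees with the unique root whenever it is unique. *)

theory Defs
  imports "HOL-Analysis.Analysis"
begin

definition nint_dist :: "real \<Rightarrow> real" where
  "nint_dist x = \<bar>x - of_int (round x)\<bar>"

definition approx_err :: "real^4 \<Rightarrow> nat \<Rightarrow> real" where
  "approx_err \<Theta> q = (MAX j. nint_dist (real q * \<Theta> $ j))"

definition lin_indep_over_Z :: "real^4 \<Rightarrow> bool" where
  "lin_indep_over_Z \<Theta> \<longleftrightarrow>
     (\<forall>(b::int) (a::4 \<Rightarrow> int).
        of_int b + (\<Sum>j\<in>UNIV. of_int (a j) * \<Theta> $ j) = 0 \<longrightarrow> b = 0 \<and> (\<forall>j. a j = 0))"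

text \<open>The minimum is meaningful for \<open>t \<ge> 1\<close> only; only the behaviour as \<open>t\<close> tends to infinity
  is used below.\<close>

definition psi :: "real^4 \<Rightarrow> real \<Rightarrow> real" where
  "psi \<Theta> t = (MIN q\<in>{q::nat. 0 < q \<and> real q \<le> t}. approx_err \<Theta> q)"

text \<open>The ordinary exponent may be infinite, hence the extended reals.\<close>

definition omega :: "real^4 \<Rightarrow> ereal" where
  "omega \<Theta> = Sup (ereal ` {\<gamma>. Liminf at_top (\<lambda>t::real. ereal (t powr \<gamma> * psi \<Theta> t)) < \<infinity>})"

definition omega_hat :: "real^4 \<Rightarrow> ereal" where
  "omega_hat \<Theta> = Sup (ereal ` {\<gamma>. Limsup at_top (\<lambda>t::real. ereal (t powr \<gamma> * psi \<Theta> t)) < \<infinity>})"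

definition best_approx_denoms :: "real^4 \<Rightarrow> nat set" where
  "best_approx_denoms \<Theta> =
     {q. 0 < q \<and> (\<forall>x. 1 \<le> x \<and> x < q \<longrightarrow> approx_err \<Theta> x > approx_err \<Theta> q)}"

text \<open>The set of denominators is infinite as soon as some coordinate of \<open>\<Theta>\<close> is irrational.\<close>

definition best_q :: "real^4 \<Rightarrow> nat \<Rightarrow> nat" where
  "best_q \<Theta> \<nu> = enumerate (best_approx_denoms \<Theta>) \<nu>"

text \<open>The five-dimensional space is represented as \<open>real \<times> (real^4)\<close>, the first factor holding the
  denominator.\<close>

definition best_z :: "real^4 \<Rightarrow> nat \<Rightarrow> real \<times> (real^4)" where
  "best_z \<Theta> \<nu> =
     (real (best_q \<Theta> \<nu>), \<chi> j. of_int (round (real (best_q \<Theta> \<nu>) * \<Theta> $ j)))"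

definition lin_indep_tuple :: "'a::real_vector list \<Rightarrow> bool" where
  "lin_indep_tuple vs \<longleftrightarrow> distinct vs \<and> independent (set vs)"

text \<open>A tuple of indices \<open>r 0 < r 1 < \<dots> < r (n + 1)\<close>; the first and the last entry play the roles
  of \<open>\<nu>\<^sub>l\<close> and \<open>k\<^sub>l\<close>. The condition \<open>1 \<le> r 0\<close> makes the index \<open>r 0 - 1\<close> exist.\<close>

definition admissible_tuple :: "real^4 \<Rightarrow> nat \<Rightarrow> (nat \<Rightarrow> nat) \<Rightarrow> bool" where
  "admissible_tuple \<Theta> n r \<longleftrightarrow>
     (let z = best_z \<Theta>; \<nu> = r 0; k = r (n + 1) in
       1 \<le> \<nu> \<and> (\<forall>i\<le>n. r i < r (i + 1)) \<and>
       (\<forall>i\<le>n+1. lin_indep_tuple [z (r i - 1), z (r i), z (r i + 1)]) \<and>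
       (\<forall>i\<le>n. \<exists>S. subspace S \<and> dim S = 2 \<and>
          (\<forall>m. r i \<le> m \<and> m \<le> r (i + 1) - 1 \<longrightarrow> span {z m, z (m + 1)} = S)) \<and>
       (\<exists>T. subspace T \<and> dim T = 3 \<and>
          (\<forall>i. 1 \<le> i \<and> i \<le> n \<longrightarrow> T = span {z (r i - 1), z (r i), z (r i + 1)}) \<and>
          z (\<nu> - 1) \<notin> T \<and> z (k + 1) \<notin> T) \<and>
       lin_indep_tuple [z (\<nu> - 1), z (r n - 1), z (k - 1), z k, z (k + 1)])"

definition approx_index :: "real^4 \<Rightarrow> enat" where
  "approx_index \<Theta> = Inf (enat ` {n. 1 \<le> n \<and>
     (\<exists>r::nat \<Rightarrow> nat \<Rightarrow> nat. filterlim (\<lambda>l. r l 0) at_top sequentially \<and>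
        (\<forall>l. admissible_tuple \<Theta> n (r l)))})"

definition G1 :: "real \<Rightarrow> real" where
  "G1 w = (let c = w / (1 - w) in THE x. 0 < x \<and> x^3 - c * x^2 - c * x - c = 0)"

definition G2 :: "real \<Rightarrow> real" where
  "G2 w = (let c = w / (1 - w) in
     if w \<le> 1/2
     then THE x. 0 < x \<and> x^4 - c * x^3 - c * x^2 + c^2 * x - w / (1 - w)^2 = 0
     else THE x. 0 < x \<and> x^4 - c * x^3 - c * x^2 + c * x - w / (1 - w)^2 = 0)"

text \<open>The polynomial equals \<open>x\<^sup>2 (x\<^sup>2 - c) (x - c) - c (c + 1)\<close>. For \<open>w\<close> near 1 it has three positive
  roots (for \<open>w = 9/10\<close> they lie in \<open>(1, 2)\<close>, \<open>(2, 3)\<close> and \<open>(9, 10)\<close>), so a definite description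
  would be unspecified there. Taking the largest positive root agrees with the unique positive
  root whenever there is one and makes a lower bound in terms of \<open>G3\<close> strongest otherwise.\<close>

definition G3_roots :: "real \<Rightarrow> real set" where
  "G3_roots w = (let c = w / (1 - w) in
     {x. 0 < x \<and> x^5 - c * x^4 - c * x^3 + c^2 * x^2 - w / (1 - w)^2 = 0})"

definition G3 :: "real \<Rightarrow> real" where
  "G3 w = Max (G3_roots w)"

lemma G3_eq_the_root:
  assumes "\<exists>!x. x \<in> G3_roots w"
  shows "G3 w = (THE x. x \<in> G3_roots w)"
proof -
  from assms obtain r where r: "G3_roots w = {r}" by auto
  show ?thesis by (simp add: G3_def r)
qed

end

theory Submission
  imports Defs
begin

text \<open>Write \<open>X\<^sub>m\<close>, \<open>L\<^sub>m\<close> for the denominator and the error of the \<open>m\<close>-th best approximation and let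
  \<open>\<nu> = r\<^sub>0\<close>, \<open>s = r\<^sub>1\<close>, \<open>k = r\<^sub>n\<^sub>+\<^sub>1\<close>
      for an admissible tuple of any length \<open>n \<ge> 1\<close>. The vectors with
  indices \<open>\<nu> - 1, s - 1, s, s + 1, k + 1\<close> are linearly independent, so their determinant is at least
  \<open>1\<close> in absolute value. Since \<open>z\<^sub>\<nu>\<close> and \<open>z\<^sub>k\<close> lie in the span \<open>T\<close> of the middle three, suitable
  multiples of them can be subtracted from the rows \<open>\<nu> - 1\<close> and \<open>k + 1\<close> to clear the first column,
  which gives
  \<open>1 \<lless> X\<^sub>s\<^sub>+\<^sub>1 L\<^sub>s L\<^sub>s\<^sub>-\<^sub>1 L\<^sub>\<nu>\<^sub>-\<^sub>1 X\<^sub>k\<^sub>+\<^sub>1 L\<^sub>k / X\<^sub>k\<close>.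
  Moreover \<open>X\<^sub>s L\<^sub>s\<^sub>-\<^sub>1 \<lless> X\<^sub>\<nu>\<^sub>+\<^sub>1 L\<^sub>\<nu>\<close>, because both sides are comparable to the covolume of the
      same
  planar lattice. If \<open>L\<^sub>m \<lless> X\<^sub>m\<^sub>+\<^sub>1\<^sup>-\<^sup>w\<close> and \<open>X\<^sub>m\<^sub>+\<^sub>1 \<lless> X\<^sub>m\<^sup>G\<close>
      for all large \<open>m\<close>, these estimates become linear
  inequalities between logarithms, and eliminating the indices \<open>\<nu>\<close> and \<open>s\<close> leaves
  \<open>(1 - w) G\<^sup>3 \<ge> w (G\<^sup>2 + G + 1)\<close>. Hence \<open>\<omega> \<ge> \<omega>' G\<^sub>1(\<omega>')\<close> with \<open>\<omega>'\<close> the uniform exponent, whatever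
      the
  index is, and \<open>G\<^sub>2\<close> and \<open>G\<^sub>3\<close> are at most \<open>G\<^sub>1\<close> on \<open>[1/4, 1)\<close>.\<close>

section \<open>The functions \<open>G1\<close>, \<open>G2\<close>, \<open>G3\<close>\<close>

text \<open>The quotient \<open>x^3 / (x^2 + x + 1)\<close> increases strictly on the positive
  reals: after cross-multiplication the difference is \<open>y - x\<close> times a positive
  polynomial. This gives both the uniqueness of the cubic root and the sign of the cubic on either
  side of it.\<close>

lemma cubic_inequality_upward:
  fixes c x y :: real
  assumes "0 < c" "0 < x" "x < y" "x^3 \<ge> c * (x^2 + x + 1)"
  shows "y^3 > c * (y^2 + y + 1)"
proof -
  have eq: "x^3 * (y^2 + y + 1) - y^3 * (x^2 + x + 1)
      = - ((y - x) * (x^2 * y^2 + x * y * (x + y) + (x^2 + x * y + y^2)))"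
    by algebra
  have "(y - x) * (x^2 * y^2 + x * y * (x + y) + (x^2 + x * y + y^2)) > 0"
    using assms by (intro mult_pos_pos add_pos_pos) auto
  then have lt: "x^3 * (y^2 + y + 1) < y^3 * (x^2 + x + 1)"
    using eq by linarith
  have "c * (x^2 + x + 1) * (y^2 + y + 1) \<le> x^3 * (y^2 + y + 1)"
    using assms by (intro mult_right_mono add_nonneg_nonneg) auto
  then have "(c * (y^2 + y + 1)) * (x^2 + x + 1) < y^3 * (x^2 + x + 1)"
    using lt by (simp add: mult_ac)
  then show ?thesis
    by (rule mult_right_less_imp_less) (use assms in \<open>auto intro!: add_nonneg_nonneg\<close>)
qed

text \<open>The cubic takes the values \<open>- c\<close> at \<open>0\<close> and \<open>1\<close>
  at \<open>c + 1\<close>, so a root lies between; the monotonicity just shown makes it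
  unique.\<close>

lemma G1_root:
  assumes "0 < w" "w < 1"
  defines "c \<equiv> w / (1 - w)"
  shows "0 < G1 w" "(G1 w)^3 = c * ((G1 w)^2 + G1 w + 1)"
proof -
  have c: "0 < c" using assms by (simp add: c_def)
  let ?f = "\<lambda>x::real. x^3 - c * x^2 - c * x - c"
  have top: "?f (c + 1) = 1" by algebra
  have "\<exists>x. 0 \<le> x \<and> x \<le> c + 1 \<and> ?f x = 0"
    by (rule IVT') (use c top in \<open>auto intro!: continuous_intros\<close>)
  then obtain x where x: "0 \<le> x" "?f x = 0" by blast
  have x0: "0 < x" using x c by (cases "x = 0") auto
  have eq: "?f y = 0 \<longleftrightarrow> y^3 = c * (y^2 + y + 1)" for y by (auto simp: algebra_simps)
  have uniq: "y = x" if "0 < y" "?f y = 0" for y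
  proof (rule ccontr)
    assume "y \<noteq> x"
    then consider "y < x" | "x < y" by linarith
    then show False
    proof cases
      case 1
      then show False
        using cubic_inequality_upward[of c y x] c x(2) that unfolding eq by linarith
    next
      case 2
      then show False
        using cubic_inequality_upward[of c x y] c x(2) x0 that unfolding eq by linarith
    qed
  qed
  have "G1 w = x"
    unfolding G1_def Let_def c_def[symmetric]
    using x0 x(2) uniq by (intro the_equality conjI) blast+
  then show "0 < G1 w" "(G1 w)^3 = c * ((G1 w)^2 + G1 w + 1)"
    using x0 x eq[of x] by simp_all
qed

text \<open>At \<open>w = 1/4\<close> one has \<open>c = 1/3\<close>, for which the root is exactly
  \<open>1\<close>. The second bound holds because \<open>g^3 - c * g^2 = c * (g + 1)\<close> is
  positive.\<close>

lemma G1_ge: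
  assumes "1/4 \<le> w" "w < 1"
  shows "1 \<le> G1 w" "w / (1 - w) < G1 w"
proof -
  define c where "c = w / (1 - w)"
  define g where "g = G1 w"
  have c: "1/3 \<le> c" using assms by (simp add: c_def field_simps)
  have g: "0 < g" "g^3 = c * (g^2 + g + 1)"
    using G1_root[of w] assms by (auto simp: g_def c_def)
  show "1 \<le> G1 w"
  proof (rule ccontr)
    assume "\<not> 1 \<le> G1 w"
    then have "g < 1" by (simp add: g_def)
    then have "1^3 > c * (1^2 + 1 + 1)"
      using cubic_inequality_upward[of c g 1] g c by auto
    then show False using c by simp
  qed
  have "g * g^2 > c * g^2"
  proof -
    have "g * g^2 = c * g^2 + c * (g + 1)" using g(2) by algebra
    moreover have "c * (g + 1) > 0" using g c by simp
    ultimately show ?thesis by linarith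
  qed
  then have "c < g"
    using g(1) by (simp add: mult_less_cancel_right)
  then show "w / (1 - w) < G1 w"
    by (simp add: g_def c_def)
qed

text \<open>Up to a factor \<open>x\<close> or \<open>x^2\<close>, the expression
  \<open>x^3 - c * x^2 - c * x\<close> forms the leading terms of the polynomials defining
  \<open>G2\<close> and \<open>G3\<close>.\<close>

lemma cubic_above_G1:
  assumes "1/4 \<le> w" "w < 1" "G1 w \<le> x"
  defines "c \<equiv> w / (1 - w)"
  shows "x^3 - c * x^2 - c * x \<ge> c" "G1 w < x \<Longrightarrow> x^3 - c * x^2 - c * x > c"
proof -
  have c: "c > 0" using assms by (simp add: c_def)
  have g: "0 < G1 w" "(G1 w)^3 = c * ((G1 w)^2 + G1 w + 1)"
    using G1_root[of w] assms by (auto simp: c_def)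
  show gt: "x^3 - c * x^2 - c * x > c" if "G1 w < x"
    using cubic_inequality_upward[of c "G1 w" x] g c that by (auto simp: algebra_simps)
  show "x^3 - c * x^2 - c * x \<ge> c"
    using gt g assms by (cases "G1 w = x") (auto simp: algebra_simps)
qed

section \<open>Comparison of the quartic and quintic roots with the cubic root\<close>

lemma unique_root_le:
  fixes f :: "real \<Rightarrow> real"
  assumes cont: "continuous_on {0..g} f" and "0 \<le> g" "f 0 < 0" "f g \<ge> 0"
    and above: "\<And>x. g < x \<Longrightarrow> f x > 0"
    and uniq: "\<And>x y. 0 < x \<Longrightarrow> x < y \<Longrightarrow> f x = 0 \<Longrightarrow> f y = 0 \<Longrightarrow> False"
  shows "(THE x. 0 < x \<and> f x = 0) \<le> g"
proof -
  obtain x where x: "0 \<le> x" "x \<le> g" "f x = 0"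
    using IVT'[of f 0 0 g] assms by auto
  then have "0 < x" using assms by (cases "x = 0") auto
  then have "(THE x. 0 < x \<and> f x = 0) = x"
    using x uniq by (intro the_equality) (auto, metis linorder_neqE_linordered_idom)
  then show ?thesis using x by simp
qed

text \<open>At a root, \<open>t * (t^2 - c) * (t - c)\<close> equals \<open>c * (c + 1)\<close>, so
  the last two factors have the same sign. If both are positive, the product is increasing from
  there on; both negative is impossible by size.\<close>

lemma G2_low_unique:
  fixes c x y :: real
  assumes "0 < c" "c \<le> 1" "0 < x" "x < y"
    and "x^4 - c * x^3 - c * x^2 + c^2 * x - c * (c + 1) = 0"
    and "y^4 - c * y^3 - c * y^2 + c^2 * y - c * (c + 1) = 0"
  shows False
proof -
  have fact: "t^4 - c * t^3 - c * t^2 + c^2 * t = t * ((t^2 - c) * (t - c))" for t by algebra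
  have x: "x * ((x^2 - c) * (x - c)) = c * (c + 1)" using assms fact[of x] by linarith
  have y: "y * ((y^2 - c) * (y - c)) = c * (c + 1)" using assms fact[of y] by linarith
  have pos: "0 < (x^2 - c) * (x - c)"
  proof -
    have "0 < x * ((x^2 - c) * (x - c))" unfolding x using assms(1) by simp
    then show ?thesis using assms(3) zero_less_mult_pos by blast
  qed
  \<comment> \<open>Two negative factors would bound the product by \<open>c^3\<close>, which is at
    most \<open>c\<close> and hence below \<open>c * (c + 1)\<close>.\<close>
  have big: "c < x \<and> c < x^2"
  proof (rule ccontr)
    assume "\<not> ?thesis"
    then have neg: "x < c" "x^2 < c" using pos by (auto simp: zero_less_mult_iff)
    have "(c - x^2) * (c - x) \<le> c * c"
      using neg assms by (intro mult_mono) auto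
    then have "x * ((c - x^2) * (c - x)) \<le> c * (c * c)"
      using neg assms by (intro mult_mono mult_nonneg_nonneg) auto
    moreover have "c * c \<le> 1" using assms(1,2) by (simp add: mult_le_one)
    then have "c * (c * c) \<le> c * 1"
      using assms(1) by (intro mult_left_mono) auto
    moreover have "(c - x^2) * (c - x) = (x^2 - c) * (x - c)" by algebra
    ultimately have "c * (c + 1) \<le> c * 1" using x by simp
    then show False using assms(1) by simp
  qed
  have "x^2 < y^2" using assms(3,4) by (intro power_strict_mono) auto
  then have "(x^2 - c) * (x - c) < (y^2 - c) * (y - c)"
    using big assms(4) by (intro mult_strict_mono) auto
  then have "x * ((x^2 - c) * (x - c)) < y * ((y^2 - c) * (y - c))"
    using pos assms(3,4) by (intro mult_strict_mono[of x y]) auto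
  then show False using x y by simp
qed

text \<open>Every positive root exceeds \<open>c\<close>. Dividing the difference of the two
  equations by \<open>y - x\<close> then leaves an identity whose left side is too large.\<close>

lemma G2_high_unique:
  fixes c x y :: real
  assumes "1 \<le> c" "0 < x" "x < y"
    and "x^4 - c * x^3 - c * x^2 + c * x - c * (c + 1) = 0"
    and "y^4 - c * y^3 - c * y^2 + c * y - c * (c + 1) = 0"
  shows False
proof -
  have cx: "c < x"
  proof -
    have "x^3 * (x - c) = c * (x^2 - x + 1 + c)" using assms(4) by algebra
    moreover have "x^2 - x + 1 = (x - 1/2)^2 + 3/4" by (simp add: power2_eq_square algebra_simps)
    ultimately have "x^3 * (x - c) > 0" using assms(1) by (simp add: add_nonneg_pos)
    then show ?thesis using assms(2) by (simp add: zero_less_mult_iff)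
  qed
  \<comment> \<open>\<open>s\<close> is the divided difference of \<open>t^3 + t^2 - t\<close>, the
    part of the polynomial that carries the coefficient \<open>- c\<close>.\<close>
  define s where "s = y^2 + x * y + x^2 + x + y - 1"
  have "(y - x) * (y^3 + y^2 * x + y * x^2 + x^3 - c * s) = 0"
    unfolding s_def using assms(4,5) by algebra
  then have z: "y^3 + y^2 * x + y * x^2 + x^3 = c * s" using assms by simp
  have "x * y > 0" using assms by simp
  then have "s > 0" unfolding s_def using cx assms(1,3) zero_le_power2[of x] zero_le_power2[of y]
      by linarith
  then have "c * s < x * s" using cx by simp
  moreover have "y^3 + y^2 * x + y * x^2 + x^3 - x * s
      = (y - x) * (y^2 + x*y + x^2 - x) + x * (x - 1)^2"
    unfolding s_def by algebra
  moreover have "(y - x) * (y^2 + x*y + x^2 - x) \<ge> 0"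
  proof -
    have "x * y \<ge> x" using cx assms by simp
    then have "y^2 + x*y + x^2 - x \<ge> 0"
      using zero_le_power2[of x] zero_le_power2[of y] by linarith
    then show ?thesis using assms by simp
  qed
  moreover have "x * (x - 1)^2 \<ge> 0" using assms by simp
  ultimately show False using z by linarith
qed

text \<open>At \<open>g = G1 w\<close> the cubic part is at least \<open>c\<close>; together with
  \<open>g \<ge> 1\<close> this makes both quartics nonnegative at \<open>g\<close>, so their unique
  positive root is at most \<open>g\<close>.\<close>

lemma G2_le_G1:
  assumes "1/4 \<le> w" "w < 1"
  shows "G2 w \<le> G1 w"
proof -
  define c where "c = w / (1 - w)"
  define g where "g = G1 w"
  have cc: "w / (1 - w)^2 = c * (c + 1)"
    using assms by (simp add: c_def field_simps power2_eq_square)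
  have c: "0 < c" using assms by (simp add: c_def)
  have g: "1 \<le> g" "c < g" using G1_ge assms by (auto simp: g_def c_def)
  have p: "c \<le> x^3 - c * x^2 - c * x" if "g \<le> x" for x
    using cubic_above_G1[of w x] assms that by (simp add: c_def g_def)
  have p': "c < x^3 - c * x^2 - c * x" if "g < x" for x
    using cubic_above_G1[of w x] assms that by (simp add: c_def g_def)
  show ?thesis
  proof (cases "w \<le> 1/2")
    case True
    let ?f = "\<lambda>x::real. x^4 - c * x^3 - c * x^2 + c^2 * x - c * (c + 1)"
    have c1: "c \<le> 1" using True assms by (simp add: c_def field_simps)
    have f: "?f x = x * (x^3 - c * x^2 - c * x + c^2) - c * (c + 1)" for x by algebra
    have "c * (c + 1) \<le> g * (g^3 - c * g^2 - c * g + c^2)"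
      using mult_mono[of 1 g "c * (c + 1)" "g^3 - c * g^2 - c * g + c^2"] p[of g] g c
      by (simp add: power2_eq_square distrib_left)
    then have "?f g \<ge> 0" using f[of g] by linarith
    moreover have "?f x > 0" if "g < x" for x
    proof -
      have "1 * (c * (c + 1)) < x * (x^3 - c * x^2 - c * x + c^2)"
        using p'[OF that] g c that
        by (intro mult_strict_mono) (auto simp: power2_eq_square distrib_left)
      then show ?thesis using f[of x] by linarith
    qed
    ultimately have "(THE x. 0 < x \<and> ?f x = 0) \<le> g"
      using G2_low_unique[OF c c1] c g
      by (intro unique_root_le) (auto intro!: continuous_intros)
    then show ?thesis
      using True by (simp add: G2_def Let_def cc flip: c_def g_def)
  next
    case False
    let ?f = "\<lambda>x::real. x^4 - c * x^3 - c * x^2 + c * x - c * (c + 1)"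
    have c1: "1 \<le> c" using False assms by (simp add: c_def field_simps)
    have f: "?f x = x * (x^3 - c * x^2 - c * x + c) - c * (c + 1)" for x by algebra
    \<comment> \<open>Here \<open>1 \<le> c < g \<le> x\<close>, hence
      \<open>c + 1 < 2 * x\<close>.\<close>
    have bd: "c * (c + 1) < x * (2 * c)" if "g \<le> x" for x
      using mult_strict_left_mono[of "c + 1" "x * 2" c] c c1 g that by (simp add: mult_ac)
    have le: "x * (2 * c) \<le> x * (x^3 - c * x^2 - c * x + c)" if "g \<le> x" for x
      using p[OF that] g that by (intro mult_left_mono) auto
    have pos: "?f x > 0" if "g \<le> x" for x
      using bd[OF that] le[OF that] f[of x] by linarith
    then have "(THE x. 0 < x \<and> ?f x = 0) \<le> g"
      using G2_high_unique[OF c1] c g less_imp_le[OF pos[of g]]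
      by (intro unique_root_le) (auto intro!: continuous_intros)
    then show ?thesis
      using False by (simp add: G2_def Let_def cc flip: c_def g_def)
  qed
qed

text \<open>Since the quintic may have several positive roots, all of them are bounded at once: the
  quintic is positive beyond \<open>G1 w\<close>.\<close>

lemma G3_le_G1:
  assumes "1/4 \<le> w" "w < 1"
  shows "G3 w \<le> G1 w"
proof -
  define c where "c = w / (1 - w)"
  define g where "g = G1 w"
  have cc: "w / (1 - w)^2 = c * (c + 1)"
    using assms by (simp add: c_def field_simps power2_eq_square)
  have c: "0 < c" using assms by (simp add: c_def)
  have g: "1 \<le> g" using G1_ge assms by (auto simp: g_def)
  let ?f = "\<lambda>x::real. x^5 - c * x^4 - c * x^3 + c^2 * x^2 - c * (c + 1)"
  have roots: "G3_roots w = {x. 0 < x \<and> ?f x = 0}"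
    by (simp add: G3_roots_def Let_def cc flip: c_def)
  have f: "?f x = x^2 * (x^3 - c * x^2 - c * x + c^2) - c * (c + 1)" for x by algebra
  have q: "c \<le> g^3 - c * g^2 - c * g"
    using cubic_above_G1(1)[of w g] assms by (simp add: g_def c_def)
  have "1 * (c * (c + 1)) \<le> g^2 * (g^3 - c * g^2 - c * g + c^2)"
  proof (rule mult_mono)
    show "c * (c + 1) \<le> g^3 - c * g^2 - c * g + c^2"
      using q by (simp add: power2_eq_square distrib_left)
  qed (use g c in auto)
  then have fg: "?f g \<ge> 0" using f[of g] by linarith
  have pos: "?f x > 0" if "g < x" for x
  proof -
    have "1 < x^2" using that g by (simp add: one_less_power)
    moreover have "c * (c + 1) < x^3 - c * x^2 - c * x + c^2"
      using cubic_above_G1(2)[of w x] assms that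
      by (simp add: g_def power2_eq_square distrib_left flip: c_def)
    ultimately have "1 * (c * (c + 1)) < x^2 * (x^3 - c * x^2 - c * x + c^2)"
      using c by (intro mult_strict_mono) auto
    then show ?thesis using f[of x] by linarith
  qed
  \<comment> \<open>\<open>Max\<close> is meaningful for a finite nonempty set only: this root gives
    nonemptiness, the polynomial \<open>?p\<close> below finiteness.\<close>
  obtain x where x: "0 \<le> x" "x \<le> g" "?f x = 0"
  proof -
    have "\<exists>x. 0 \<le> x \<and> x \<le> g \<and> ?f x = 0"
      by (rule IVT') (use fg c g in \<open>auto intro!: continuous_intros\<close>)
    then show ?thesis using that by blast
  qed
  moreover from this have "x \<noteq> 0" using c by auto
  ultimately have ne: "G3_roots w \<noteq> {}" unfolding roots by force
  let ?p = "[:- c * (c + 1), 0, c^2, - c, - c, 1:]"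
  have "poly ?p x = ?f x" for x
    by (simp add: eval_nat_numeral power2_eq_square distrib_left right_diff_distrib mult_ac)
  then have "G3_roots w \<subseteq> {x. poly ?p x = 0}" unfolding roots by auto
  then have fin: "finite (G3_roots w)"
    by (rule finite_subset) (rule poly_roots_finite, simp)
  have "x \<le> G1 w" if "x \<in> G3_roots w" for x
  proof (rule ccontr)
    assume "\<not> x \<le> G1 w"
    then have "?f x > 0" using pos[of x] by (simp add: g_def)
    moreover have "?f x = 0" using that unfolding roots by blast
    ultimately show False by linarith
  qed
  then show ?thesis
    unfolding G3_def using fin ne by simp
qed

section \<open>Best approximations\<close>

text \<open>The signed error, which is linear in the vector, whereas \<open>approx_err\<close>
  involves rounding. On best approximations its sup norm is \<open>approx_err\<close>.\<close>

definition err_vec :: "real^4 \<Rightarrow> real \<times> (real^4) \<Rightarrow> real^4" where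
  "err_vec \<Theta> z = fst z *\<^sub>R \<Theta> - snd z"

definition integral_vec :: "real \<times> (real^4) \<Rightarrow> bool" where
  "integral_vec z \<longleftrightarrow> fst z \<in> \<int> \<and> (\<forall>j. snd z $ j \<in> \<int>)"

lemma err_vec_add: "err_vec \<Theta> (u + v) = err_vec \<Theta> u + err_vec \<Theta> v"
  and err_vec_diff: "err_vec \<Theta> (u - v) = err_vec \<Theta> u - err_vec \<Theta> v"
  and err_vec_minus: "err_vec \<Theta> (- u) = - err_vec \<Theta> u"
  and err_vec_scaleR: "err_vec \<Theta> (a *\<^sub>R u) = a *\<^sub>R err_vec \<Theta> u"
  by (simp_all add: err_vec_def algebra_simps)

lemma integral_vec_diff: "integral_vec u \<Longrightarrow> integral_vec v \<Longrightarrow> integral_vec (u - v)"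
  and integral_vec_minus: "integral_vec u \<Longrightarrow> integral_vec (- u)"
  and integral_vec_scaleR: "integral_vec u \<Longrightarrow> a \<in> \<int> \<Longrightarrow> integral_vec (a *\<^sub>R u)"
  by (simp_all add: integral_vec_def)

lemma infnorm_le_iff: "infnorm (v :: real^'n) \<le> b \<longleftrightarrow> (\<forall>j. \<bar>v $ j\<bar> \<le> b)"
proof
  show "infnorm v \<le> b \<Longrightarrow> \<forall>j. \<bar>v $ j\<bar> \<le> b"
    using component_le_infnorm_cart order_trans by blast
  show "\<forall>j. \<bar>v $ j\<bar> \<le> b \<Longrightarrow> infnorm v \<le> b"
    unfolding infnorm_cart by (rule cSup_least) auto
qed

lemma infnorm_diff_ge: "infnorm a - infnorm b \<le> infnorm (a - b)"
  using absdiff_infnorm[of a b] by linarith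

lemma nint_dist_le: "nint_dist x \<le> \<bar>x - of_int n\<bar>"
  unfolding nint_dist_def using round_diff_minimal[of x n] by simp

lemma approx_err_le_iff: "approx_err \<Theta> q \<le> b \<longleftrightarrow> (\<forall>j. nint_dist (real q * \<Theta> $ j) \<le> b)"
  unfolding approx_err_def by (subst Max_le_iff) auto

lemma nint_dist_le_approx_err: "nint_dist (real q * \<Theta> $ j) \<le> approx_err \<Theta> q"
  using approx_err_le_iff by blast

lemma approx_err_le_infnorm:
  assumes "integral_vec u" "fst u = real q"
  shows "approx_err \<Theta> q \<le> infnorm (err_vec \<Theta> u)"
proof -
  have "nint_dist (real q * \<Theta> $ j) \<le> infnorm (err_vec \<Theta> u)" for j
  proof -
    obtain n where n: "snd u $ j = of_int n" using assms unfolding integral_vec_def Ints_def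
        by blast
    have "nint_dist (real q * \<Theta> $ j) \<le> \<bar>real q * \<Theta> $ j - of_int n\<bar>" by (rule nint_dist_le)
    also have "\<dots> = \<bar>err_vec \<Theta> u $ j\<bar>" using assms n by (simp add: err_vec_def)
    finally show ?thesis using component_le_infnorm_cart order_trans by blast
  qed
  then show ?thesis by (simp add: approx_err_le_iff)
qed

lemma integral_vec_best_z: "integral_vec (best_z \<Theta> m)"
  by (simp add: integral_vec_def best_z_def)

lemma fst_best_z: "fst (best_z \<Theta> m) = real (best_q \<Theta> m)"
  by (simp add: best_z_def)

lemma approx_err_best_q: "infnorm (err_vec \<Theta> (best_z \<Theta> m)) = approx_err \<Theta> (best_q \<Theta> m)"
proof (rule antisym)
  show "approx_err \<Theta> (best_q \<Theta> m) \<le> infnorm (err_vec \<Theta> (best_z \<Theta> m))"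
    by (rule approx_err_le_infnorm) (simp_all add: integral_vec_best_z fst_best_z)
  show "infnorm (err_vec \<Theta> (best_z \<Theta> m)) \<le> approx_err \<Theta> (best_q \<Theta> m)"
    unfolding infnorm_le_iff
    using nint_dist_le_approx_err[of "best_q \<Theta> m" \<Theta>]
    by (simp add: err_vec_def best_z_def nint_dist_def)
qed

lemma approx_err_nonneg: "0 \<le> approx_err \<Theta> q"
  using nint_dist_le_approx_err[of q \<Theta> 1] by (simp add: nint_dist_def)

lemma approx_err_le_half: "approx_err \<Theta> q \<le> 1/2"
  unfolding approx_err_le_iff nint_dist_def
  using of_int_round_abs_le by (metis abs_minus_commute)

lemma Dirichlet_approx_err:
  assumes "N > 0"
  obtains q where "0 < q" "q \<le> N^4" "approx_err \<Theta> q \<le> 1 / real N"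
proof -
  \<comment> \<open>Dirichlet's theorem numbers the coordinates from \<open>0\<close> to
    \<open>3\<close>; \<open>pos\<close> carries these numbers to the index type
    \<open>4\<close>.\<close>
  define pos :: "nat \<Rightarrow> 4" where "pos i = (if i = 0 then 1 else if i = 1 then 2 else if i
      = 2 then 3 else 4)" for i
  obtain q p where q: "0 < q" "q \<le> int (N^4)"
    and p: "\<And>i. i < 4 \<Longrightarrow> \<bar>of_int q * \<Theta> $ pos i - of_int (p i)\<bar> < 1 / real N"
    using Dirichlet_approx_simult[OF assms, of 4 "\<lambda>i. \<Theta> $ pos i"] by metis
  have surj: "\<exists>i<4. pos i = j" for j
  proof -
    have "pos 0 = 1" "pos 1 = 2" "pos 2 = 3" "pos 3 = 4" by (simp_all add: pos_def)
    then show ?thesis using exhaust_4[of j]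
      by (metis numeral_less_iff semiring_norm(76,77,78,80,81) less_numeral_extra
          zero_less_numeral one_less_numeral_iff)
  qed
  have "approx_err \<Theta> (nat q) \<le> 1 / real N"
    unfolding approx_err_le_iff
  proof
    fix j
    obtain i where i: "i < 4" "pos i = j" using surj by blast
    have "nint_dist (real (nat q) * \<Theta> $ j) \<le> \<bar>real (nat q) * \<Theta> $ j - of_int (p i)\<bar>"
      by (rule nint_dist_le)
    also have "\<dots> < 1 / real N" using p[OF i(1)] i(2) q(1) by simp
    finally show "nint_dist (real (nat q) * \<Theta> $ j) \<le> 1 / real N" by simp
  qed
  then show ?thesis using that[of "nat q"] q by (simp add: nat_le_iff zero_less_nat_eq)
qed

text \<open>A vanishing error in the first coordinate alone is already an integer relation between
  \<open>1\<close> and that coordinate.\<close>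

lemma approx_err_pos:
  assumes "lin_indep_over_Z \<Theta>" "0 < q"
  shows "0 < approx_err \<Theta> q"
proof (rule ccontr)
  assume "\<not> ?thesis"
  then have "nint_dist (real q * \<Theta> $ 1) \<le> 0"
    using nint_dist_le_approx_err[of q \<Theta> 1] by linarith
  then have r: "real q * \<Theta> $ 1 = of_int (round (real q * \<Theta> $ 1))"
    by (simp add: nint_dist_def)
  define a :: "4 \<Rightarrow> int" where "a = (\<lambda>j. if j = 1 then int q else 0)"
  have "(\<Sum>j\<in>UNIV. of_int (a j) * \<Theta> $ j) = (\<Sum>j\<in>(UNIV::4 set). if j = 1 then real q * \<Theta> $ 1 else 0)"
    unfolding a_def by (intro sum.cong) auto
  also have "\<dots> = real q * \<Theta> $ 1" by simp
  finally have "of_int (- round (real q * \<Theta> $ 1)) + (\<Sum>j\<in>UNIV. of_int (a j) * \<Theta> $ j) = 0"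
    using r by simp
  then have "a 1 = 0" using assms(1) unfolding lin_indep_over_Z_def by blast
  then show False using assms(2) by (simp add: a_def)
qed

text \<open>Take the least positive integer whose error is at most that of \<open>q\<close>; every
  smaller one has a strictly larger error.\<close>

lemma ex_best_approx_denom_below:
  assumes "0 < q"
  obtains p where "p \<in> best_approx_denoms \<Theta>" "p \<le> q" "approx_err \<Theta> p \<le> approx_err \<Theta> q"
proof -
  define P where "P x \<longleftrightarrow> 0 < x \<and> approx_err \<Theta> x \<le> approx_err \<Theta> q" for x
  define p where "p = (LEAST x. P x)"
  have "P q" using assms by (simp add: P_def)
  then have p: "P p" "p \<le> q" "\<And>x. x < p \<Longrightarrow> \<not> P x"
    unfolding p_def by (auto intro: LeastI Least_le dest: not_less_Least)
  have "approx_err \<Theta> p < approx_err \<Theta> x" if "1 \<le> x" "x < p" for x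
    using p(1) p(3)[OF that(2)] that(1) by (auto simp: P_def)
  then have "p \<in> best_approx_denoms \<Theta>"
    using p(1) by (auto simp: best_approx_denoms_def P_def)
  then show ?thesis using that p by (auto simp: P_def)
qed

text \<open>If all best denominators were at most \<open>Q\<close>, the least error \<open>e\<close>
  up to \<open>Q\<close> would be positive. Dirichlet's theorem yields an error below
  \<open>e\<close>, and with it a best denominator of error below \<open>e\<close>.\<close>

lemma infinite_best_approx_denoms:
  assumes "lin_indep_over_Z \<Theta>"
  shows "infinite (best_approx_denoms \<Theta>)"
proof
  assume fin: "finite (best_approx_denoms \<Theta>)"
  define Q where "Q = Max (insert 1 (best_approx_denoms \<Theta>))"
  have Q: "1 \<le> Q" "\<And>p. p \<in> best_approx_denoms \<Theta> \<Longrightarrow> p \<le> Q"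
    unfolding Q_def using fin by auto
  define e where "e = Min (approx_err \<Theta> ` {1..Q})"
  have e: "e \<in> approx_err \<Theta> ` {1..Q}" "\<And>x. 1 \<le> x \<Longrightarrow> x \<le> Q \<Longrightarrow> e \<le> approx_err \<Theta> x"
    unfolding e_def using Q(1) by (intro Min_in) auto
  have "0 < e" using e(1) approx_err_pos[OF assms] by auto
  then obtain N where N: "0 < N" "1 / real N < e"
    using reals_Archimedean[of e] by (metis inverse_eq_divide zero_less_Suc)
  obtain q where q: "0 < q" "approx_err \<Theta> q \<le> 1 / real N"
    using Dirichlet_approx_err[OF N(1)] by metis
  obtain p where p: "p \<in> best_approx_denoms \<Theta>" "approx_err \<Theta> p \<le> approx_err \<Theta> q"
    using ex_best_approx_denom_below[OF q(1)] by metis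
  have "1 \<le> p" "p \<le> Q" using p Q by (auto simp: best_approx_denoms_def)
  then show False using e(2)[of p] p q N by linarith
qed

section \<open>The sequence of best approximations of an independent point\<close>

locale independent_point =
  fixes \<Theta> :: "real^4"
  assumes indep: "lin_indep_over_Z \<Theta>"
begin

abbreviation "X \<equiv> best_q \<Theta>"
abbreviation "L m \<equiv> approx_err \<Theta> (X m)"
abbreviation "z \<equiv> best_z \<Theta>"

lemma X_mem: "X m \<in> best_approx_denoms \<Theta>"
  unfolding best_q_def using enumerate_in_set infinite_best_approx_denoms[OF indep] by blast

lemma X_pos: "0 < X m"
  using X_mem by (auto simp: best_approx_denoms_def)

lemma X_less: "m < n \<Longrightarrow> X m < X n"
  unfolding best_q_def using enumerate_mono infinite_best_approx_denoms[OF indep] by blast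

lemma X_le: "m \<le> n \<Longrightarrow> X m \<le> X n"
  using X_less[of m n] by (cases "m = n") auto

lemma X_ge: "m \<le> X m"
  unfolding best_q_def using le_enumerate infinite_best_approx_denoms[OF indep] by blast

lemma L_pos: "0 < L m"
  using approx_err_pos indep X_pos by blast

lemma L_less: "m < n \<Longrightarrow> L n < L m"
  using X_mem[of n] X_less[of m n] X_pos[of m] by (auto simp: best_approx_denoms_def)

text \<open>Some best denominator up to \<open>q\<close> does at least as well as \<open>q\<close>;
  it is one of \<open>X 0\<close> to \<open>X m\<close>, and the errors decrease.\<close>

lemma L_le_approx_err:
  assumes "0 < q" "q < X (Suc m)"
  shows "L m \<le> approx_err \<Theta> q"
proof -
  obtain p where p: "p \<in> best_approx_denoms \<Theta>" "p \<le> q" "approx_err \<Theta> p \<le> approx_err \<Theta> q"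
    using ex_best_approx_denom_below[OF assms(1)] by metis
  obtain i where i: "p = X i"
    using enumerate_Ex[OF infinite_best_approx_denoms[OF indep] p(1)] unfolding best_q_def by metis
  have "\<not> Suc m \<le> i" using X_le[of "Suc m" i] p assms i by linarith
  then have "L m \<le> L i" using L_less[of i m] by (cases "i = m") auto
  then show ?thesis using p i by simp
qed

lemma L_le_infnorm:
  assumes "integral_vec u" "fst u \<noteq> 0" "\<bar>fst u\<bar> < real (X (Suc m))"
  shows "L m \<le> infnorm (err_vec \<Theta> u)"
proof -
  have pos: "L m \<le> infnorm (err_vec \<Theta> v)"
    if v: "integral_vec v" "0 < fst v" "fst v < real (X (Suc m))" for v
  proof -
    obtain n where n: "fst v = of_int n" using v unfolding integral_vec_def Ints_def by blast
    then have q: "fst v = real (nat n)" "0 < nat n" using v by auto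
    then have "L m \<le> approx_err \<Theta> (nat n)" using v by (intro L_le_approx_err) auto
    then show ?thesis using approx_err_le_infnorm[OF v(1) q(1)] by (rule order_trans)
  qed
  show ?thesis
  proof (cases "0 < fst u")
    case True
    then show ?thesis using pos[of u] assms by simp
  next
    case False
    then show ?thesis
      using pos[of "- u"] assms by (simp add: integral_vec_minus err_vec_minus infnorm_neg)
  qed
qed

text \<open>Reduce the coefficients modulo the lattice to absolute value at most \<open>1/2\<close>; what remains
  would approximate too well unless it vanishes.\<close>

lemma integral_combination:
  assumes u: "integral_vec u" "u \<in> span {z m, z (Suc m)}"
  obtains a b where "a \<in> \<int>" "b \<in> \<int>" "u = a *\<^sub>R z m + b *\<^sub>R z (Suc m)"
proof -
  obtain s t where st: "u = s *\<^sub>R z m + t *\<^sub>R z (Suc m)"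
  proof -
    obtain s where "u - s *\<^sub>R z m \<in> span {z (Suc m)}"
      using u(2) unfolding span_insert[of "z m"] by blast
    then obtain t where "u - s *\<^sub>R z m = t *\<^sub>R z (Suc m)"
      unfolding span_singleton by blast
    then show ?thesis using that[of s t] by (simp add: algebra_simps)
  qed
  define a b where "a = real_of_int (round s)" and "b = real_of_int (round t)"
  have ab: "a \<in> \<int>" "b \<in> \<int>" by (simp_all add: a_def b_def)
  define v where "v = u - a *\<^sub>R z m - b *\<^sub>R z (Suc m)"
  have v: "v = (s - a) *\<^sub>R z m + (t - b) *\<^sub>R z (Suc m)"
    by (simp add: v_def st algebra_simps)
  have half: "\<bar>s - a\<bar> \<le> 1/2" "\<bar>t - b\<bar> \<le> 1/2"
    unfolding a_def b_def using of_int_round_abs_le by (metis abs_minus_commute)+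
  have iv: "integral_vec v"
    unfolding v_def by (intro integral_vec_diff integral_vec_scaleR u integral_vec_best_z ab)
  have "\<bar>fst v\<bar> \<le> \<bar>s - a\<bar> * real (X m) + \<bar>t - b\<bar> * real (X (Suc m))"
    unfolding v using abs_triangle_ineq[of "(s - a) * real (X m)" "(t - b) * real (X (Suc m))"]
    by (simp add: fst_best_z abs_mult)
  also have "\<dots> \<le> 1/2 * real (X m) + 1/2 * real (X (Suc m))"
    using half by (intro add_mono mult_right_mono) auto
  also have "\<dots> < real (X (Suc m))" using X_less[of m "Suc m"] by simp
  finally have q: "\<bar>fst v\<bar> < real (X (Suc m))" .
  have "infnorm (err_vec \<Theta> v) \<le> \<bar>s - a\<bar> * L m + \<bar>t - b\<bar> * L (Suc m)"
    unfolding v err_vec_add err_vec_scaleR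
    using infnorm_triangle[of "(s - a) *\<^sub>R err_vec \<Theta> (z m)" "(t - b) *\<^sub>R err_vec \<Theta> (z (Suc m))"]
    by (simp add: infnorm_mul approx_err_best_q)
  also have "\<dots> \<le> 1/2 * L m + 1/2 * L (Suc m)"
    using half by (intro add_mono mult_right_mono approx_err_nonneg) auto
  also have "\<dots> < L m" using L_less[of m "Suc m"] by simp
  finally have e: "infnorm (err_vec \<Theta> v) < L m" .
  have 0: "fst v = 0"
    using L_le_infnorm[OF iv _ q] e by fastforce
  \<comment> \<open>With first coordinate \<open>0\<close>, the error vector is minus the integral
    part of \<open>v\<close>, whose entries are therefore integers of absolute value below
    \<open>1\<close>.\<close>
  have "snd v $ j = 0" for j
  proof -
    have "\<bar>snd v $ j\<bar> \<le> infnorm (err_vec \<Theta> v)"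
      using component_le_infnorm_cart[of "err_vec \<Theta> v" j] 0 by (simp add: err_vec_def)
    then have "\<bar>snd v $ j\<bar> < 1" using e approx_err_le_half[of \<Theta> "X m"] by linarith
    then show ?thesis using iv Ints_nonzero_abs_less1 unfolding integral_vec_def by blast
  qed
  then have "v = 0" using 0 by (simp add: prod_eq_iff vec_eq_iff)
  then have "u = a *\<^sub>R z m + b *\<^sub>R z (Suc m)" by (simp add: v_def algebra_simps)
  then show ?thesis using that ab by blast
qed

text \<open>In the coordinates given by the denominator and the errors, \<open>wedge u v\<close> consists of the
  minors of \<open>u, v\<close> that dominate the covolume of the lattice they span.\<close>

definition wedge :: "real \<times> (real^4) \<Rightarrow> real \<times> (real^4) \<Rightarrow> real^4" where
  "wedge u v = fst u *\<^sub>R err_vec \<Theta> v - fst v *\<^sub>R err_vec \<Theta> u"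

lemma wedge_combination:
  "wedge (a *\<^sub>R u + b *\<^sub>R v) (c *\<^sub>R u + d *\<^sub>R v) = (a * d - b * c) *\<^sub>R wedge u v"
  by (simp add: wedge_def err_vec_add err_vec_scaleR algebra_simps)

lemma wedge_upper: "infnorm (wedge (z m) (z (Suc m))) \<le> 2 * (real (X (Suc m)) * L m)"
proof -
  have "infnorm (wedge (z m) (z (Suc m))) \<le> real (X m) * L (Suc m) + real (X (Suc m)) * L m"
    unfolding wedge_def
    using infnorm_triangle[of "fst (z m) *\<^sub>R err_vec \<Theta> (z (Suc m))" "- (fst (z (Suc m)) *\<^sub>R
        err_vec \<Theta> (z m))"]
    by (simp add: infnorm_mul infnorm_neg approx_err_best_q fst_best_z)
  also have "real (X m) * L (Suc m) \<le> real (X (Suc m)) * L m"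
    using X_less[of m "Suc m"] L_less[of m "Suc m"]
        by (intro mult_mono) (auto simp: approx_err_nonneg)
  finally show ?thesis by (simp add: mult.commute)
qed

text \<open>If the denominator at least doubles, \<open>X (Suc m) * L m\<close> is at least twice
  the competing term. Otherwise \<open>z m\<close> is replaced by the difference \<open>d\<close>,
  which changes \<open>wedge\<close> only by a sign: its denominator is less than half of
  \<open>X (Suc m)\<close>, and its error is still at least \<open>L m\<close>.\<close>

lemma wedge_lower: "real (X (Suc m)) * L m \<le> 2 * infnorm (wedge (z m) (z (Suc m)))"
proof (cases "2 * X m \<le> X (Suc m)")
  case True
  have "real (X (Suc m)) * L m - real (X m) * L (Suc m) \<le> infnorm (wedge (z m) (z (Suc m)))"
    unfolding wedge_def
    using infnorm_diff_ge[of "fst (z (Suc m)) *\<^sub>R err_vec \<Theta> (z m)" "fst (z m) *\<^sub>R err_vec \<Theta> (z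
        (Suc m))"]
    by (subst infnorm_sub) (simp add: infnorm_mul approx_err_best_q fst_best_z)
  moreover have "2 * real (X m) * L (Suc m) \<le> real (X (Suc m)) * L m"
    using True L_less[of m "Suc m"] by (intro mult_mono) (auto simp: approx_err_nonneg)
  ultimately show ?thesis by linarith
next
  case False
  define d where "d = z (Suc m) - z m"
  have fd: "fst d = real (X (Suc m)) - real (X m)" by (simp add: d_def fst_best_z)
  have "L m \<le> infnorm (err_vec \<Theta> d)"
    using X_less[of m "Suc m"] X_pos[of m]
    by (intro L_le_infnorm) (auto simp: fd d_def fst_best_z intro!: integral_vec_diff
        integral_vec_best_z)
  then have 1: "real (X (Suc m)) * L m \<le> real (X (Suc m)) * infnorm (err_vec \<Theta> d)"
    by (intro mult_left_mono) auto
  have w: "wedge (z m) (z (Suc m)) = fst (z (Suc m)) *\<^sub>R err_vec \<Theta> d - fst d *\<^sub>R err_vec \<Theta> (z (Suc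
      m))"
    by (simp add: wedge_def d_def err_vec_diff algebra_simps)
  have "real (X (Suc m)) * infnorm (err_vec \<Theta> d) - fst d * L (Suc m)
      \<le> infnorm (wedge (z m) (z (Suc m)))"
    unfolding w
    using infnorm_diff_ge[of "fst (z (Suc m)) *\<^sub>R err_vec \<Theta> d" "fst d *\<^sub>R err_vec \<Theta> (z (Suc m))"]
      X_less[of m "Suc m"]
    by (simp add: infnorm_mul approx_err_best_q fst_best_z fd)
  moreover have "2 * fst d * L (Suc m) \<le> real (X (Suc m)) * L m"
    using False L_less[of m "Suc m"] X_less[of m "Suc m"] unfolding fd
    by (intro mult_mono) (auto simp: approx_err_nonneg)
  ultimately show ?thesis using 1 by linarith
qed

text \<open>The second pair arises from the first by an integral matrix of nonzero determinant, so
  \<open>wedge\<close> cannot shrink. The factor \<open>4\<close> combines the two factors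
  \<open>2\<close> comparing \<open>wedge\<close> with \<open>X (Suc m) * L m\<close>.\<close>

lemma same_plane_covolume:
  assumes "z n \<in> span {z m, z (Suc m)}" "z (Suc n) \<in> span {z m, z (Suc m)}"
  shows "real (X (Suc m)) * L m \<le> 4 * (real (X (Suc n)) * L n)"
proof -
  obtain a b where ab: "a \<in> \<int>" "b \<in> \<int>" "z n = a *\<^sub>R z m + b *\<^sub>R z (Suc m)"
    using integral_combination[OF integral_vec_best_z assms(1)] by metis
  obtain c d where cd: "c \<in> \<int>" "d \<in> \<int>" "z (Suc n) = c *\<^sub>R z m + d *\<^sub>R z (Suc m)"
    using integral_combination[OF integral_vec_best_z assms(2)] by metis
  have w: "infnorm (wedge (z n) (z (Suc n))) = \<bar>a * d - b * c\<bar> * infnorm (wedge (z m) (z (Suc m)))"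
    unfolding ab(3) cd(3) wedge_combination by (simp add: infnorm_mul)
  have "0 < real (X (Suc n)) * L n" using X_pos L_pos by simp
  then have "a * d - b * c \<noteq> 0" using w wedge_lower[of n] by auto
  then have "1 \<le> \<bar>a * d - b * c\<bar>" using ab cd by (intro Ints_nonzero_abs_ge1) auto
  then have "1 * infnorm (wedge (z m) (z (Suc m))) \<le> infnorm (wedge (z n) (z (Suc n)))"
    unfolding w by (intro mult_right_mono infnorm_pos_le)
  then show ?thesis using wedge_lower[of m] wedge_upper[of n] by linarith
qed

end

section \<open>Determinants\<close>

lemma det_Ints:
  fixes A :: "real^'n^'n"
  assumes "\<And>i j. A $ i $ j \<in> \<int>"
  shows "det A \<in> \<int>"
  unfolding det_def using assms by (intro Ints_sum Ints_mult Ints_prod) auto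

lemma det_nonzero_if_span_rows:
  fixes R :: "'n::finite \<Rightarrow> real^'n"
  assumes "span (range R) = UNIV"
  shows "det (\<chi> i. R i) \<noteq> 0"
proof -
  have "rows (\<chi> i. R i) = range R"
    by (auto simp: rows_def row_def vec_lambda_eta)
  then show ?thesis
    using assms matrix_left_invertible_span_rows[of "\<chi> i. R i"]
    by (simp add: invertible_left_inverse flip: invertible_det_nz)
qed

lemma det_add_row_span:
  fixes R :: "'n::finite \<Rightarrow> real^'n"
  assumes "x \<in> span (R ` (- {i}))"
  shows "det (\<chi> k. (R(i := R i + x)) k) = det (\<chi> k. R k)"
proof -
  have "{row j (\<chi> k. R k) |j. j \<noteq> i} = R ` (- {i})"
    by (auto simp: row_def vec_lambda_eta)
  then have "det (\<chi> k. if k = i then row i (\<chi> k. R k) + x else row k (\<chi> k. R k)) = det (\<chi> k. R k)"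
    using assms by (intro det_row_span) (simp add: span_vec_eq)
  then show ?thesis by (simp add: fun_upd_def row_def vec_lambda_eta if_distrib cong: if_cong)
qed

lemma det_option_bound:
  fixes A :: "real^('a::finite option)^('a option)"
  assumes zero: "\<And>i. A $ Some i $ None = 0"
    and b: "\<And>i j. \<bar>A $ Some i $ Some j\<bar> \<le> b i"
  shows "\<bar>det A\<bar> \<le> fact (CARD('a option)) * (\<bar>A $ None $ None\<bar> * (\<Prod>i\<in>UNIV. b i))"
proof -
  define B where "B = \<bar>A $ None $ None\<bar> * (\<Prod>i\<in>UNIV. b i)"
  have b0: "0 \<le> b i" for i using b[of i undefined] by linarith
  have B0: "0 \<le> B" unfolding B_def by (intro mult_nonneg_nonneg prod_nonneg) (auto simp: b0)
  have term_le: "\<bar>of_int (sign p) * (\<Prod>i\<in>UNIV. A $ i $ p i)\<bar> \<le> B" if p: "p permutes UNIV" for p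
  proof -
    have "\<bar>of_int (sign p) * (\<Prod>i\<in>UNIV. A $ i $ p i)\<bar> = (\<Prod>i\<in>UNIV. \<bar>A $ i $ p i\<bar>)"
      by (simp add: abs_mult sign_def abs_prod)
    also have "\<dots> = \<bar>A $ None $ p None\<bar> * (\<Prod>i\<in>UNIV. \<bar>A $ Some i $ p (Some i)\<bar>)"
      unfolding UNIV_option_conv by (subst prod.insert) (auto simp: prod.reindex)
    also have "\<dots> \<le> B"
    proof (cases "p None = None")
      case True
      have "\<bar>A $ Some i $ p (Some i)\<bar> \<le> b i" for i
      proof -
        have "p (Some i) \<noteq> None"
          using True permutes_inj[OF p] by (metis injD option.distinct(1))
        then show ?thesis using b by (metis option.exhaust)
      qed
      then show ?thesis
        unfolding B_def True by (intro mult_left_mono prod_mono) auto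
    next
      case False
      obtain i where i: "p i = None"
        using permutes_surj[OF p] by (metis surjD)
      with False obtain k where "i = Some k" by (metis option.exhaust)
      then have "\<exists>i. A $ Some i $ p (Some i) = 0" using i zero by metis
      then have "(\<Prod>i\<in>UNIV. \<bar>A $ Some i $ p (Some i)\<bar>) = 0"
        by (simp add: prod_zero_iff)
      then show ?thesis using B0 by (simp only: mult_zero_right)
    qed
    finally show ?thesis .
  qed
  have "\<bar>det A\<bar> \<le> (\<Sum>p\<in>{p. p permutes UNIV}. \<bar>of_int (sign p) * (\<Prod>i\<in>UNIV. A $ i $ p i)\<bar>)"
    unfolding det_def by (rule sum_abs)
  also have "\<dots> \<le> of_nat (card {p. p permutes (UNIV :: 'a option set)}) * B"
    using term_le by (intro sum_bounded_above) auto
  also have "card {p. p permutes (UNIV :: 'a option set)} = fact (CARD('a option))"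
    by (rule card_permutations) auto
  finally show ?thesis unfolding B_def of_nat_fact .
qed

section \<open>Determinants of five integral vectors\<close>

definition flatten :: "real \<times> (real^4) \<Rightarrow> real^(4 option)" where
  "flatten v = (\<chi> i. case i of None \<Rightarrow> fst v | Some j \<Rightarrow> snd v $ j)"

lemma flatten_nth [simp]: "flatten v $ None = fst v" "flatten v $ Some j = snd v $ j"
  by (simp_all add: flatten_def)

lemma linear_flatten: "linear flatten"
  by (rule linearI) (auto simp: vec_eq_iff flatten_def split: option.split)

lemma surj_flatten: "surj flatten"
proof (rule surjI)
  show "flatten (x $ None, \<chi> j. x $ Some j) = x" for x
    by (auto simp: vec_eq_iff flatten_def split: option.split)
qed

text \<open>The determinant of the rows \<open>u0, u 1, \<dots>, u 4\<close> is a nonzero integer.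
  Subtracting \<open>p j\<close> from row \<open>j\<close> clears the column of denominators and
  leaves the error of \<open>u j - p j\<close>, up to sign, in the other columns. The constant is
  \<open>5!\<close>.\<close>

lemma integral_det_estimate:
  fixes u p :: "4 \<Rightarrow> real \<times> (real^4)"
  assumes int: "integral_vec u0" "\<And>j. integral_vec (u j)"
    and span: "span (insert u0 (range u)) = UNIV"
    and p12: "p 1 \<in> span {u0}" "p 2 \<in> span {u0}"
    and p34: "p 3 \<in> span {u0, u 1, u 2}" "p 4 \<in> span {u0, u 1, u 2}"
    and fst_p: "\<And>j. fst (p j) = fst (u j)"
  shows "1 \<le> 120 * (\<bar>fst u0\<bar> * (\<Prod>j\<in>UNIV. infnorm (err_vec \<Theta> (u j - p j))))"
proof -
  \<comment> \<open>\<open>J\<close> records the rows that have already been reduced.\<close>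
  define S where "S J = case_option (flatten u0) (\<lambda>j. flatten (if j \<in> J then u j - p j else u j))"
      for J :: "4 set"
  have flatten_span: "- flatten x \<in> span V" if "x \<in> span U" "flatten ` U \<subseteq> span V" for x U V
  proof -
    have "flatten x \<in> span (flatten ` U)"
      using that(1) linear_span_image[OF linear_flatten] by blast
    then have "flatten x \<in> span V" using that(2) span_minimal subspace_span by blast
    then show ?thesis by (rule span_neg)
  qed
  have step: "det (\<chi> k. S (insert j J) k) = det (\<chi> k. S J k)"
    if "j \<notin> J" "p j \<in> span U" "flatten ` U \<subseteq> span (S J ` (- {Some j}))" for j J U
  proof -
    have upd: "S (insert j J) = (S J)(Some j := S J (Some j) + - flatten (p j))"
      using that(1) linear_diff[OF linear_flatten]
      by (auto simp: S_def fun_eq_iff split: option.split)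
    show ?thesis
      unfolding upd by (rule det_add_row_span) (rule flatten_span[OF that(2,3)])
  qed
  have mem0: "flatten u0 \<in> span (S J ` (- {Some j}))" for j J
    by (rule span_base) (auto simp: S_def image_iff intro!: bexI[of _ None])
  have mem: "flatten (u i) \<in> span (S J ` (- {Some j}))" if "i \<noteq> j" "i \<notin> J" for i j J
    by (rule span_base) (use that in \<open>auto simp: S_def image_iff intro!: bexI[of _ "Some i"]\<close>)
  \<comment> \<open>Read backwards, the chain reduces rows 4 and 3 while rows 1 and 2, needed to
    express \<open>p 4\<close> and \<open>p 3\<close>, are still intact; rows 2 and 1
    follow.\<close>
  have "det (\<chi> k. S {1,2,3,4} k) = det (\<chi> k. S {2,3,4} k)"
    by (rule step[OF _ p12(1)]) (auto simp: mem0)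
  also have "\<dots> = det (\<chi> k. S {3,4} k)"
    by (rule step[OF _ p12(2)]) (auto simp: mem0)
  also have "\<dots> = det (\<chi> k. S {4} k)"
    by (rule step[OF _ p34(1)]) (auto simp: mem0 intro!: mem)
  also have "\<dots> = det (\<chi> k. S {} k)"
    by (rule step[OF _ p34(2)]) (auto simp: mem0 intro!: mem)
  finally have eq: "det (\<chi> k. S UNIV k) = det (\<chi> k. S {} k)" by (simp add: UNIV_4)
  have "range (S {}) = flatten ` insert u0 (range u)"
    unfolding UNIV_option_conv by (auto simp: S_def image_iff)
  then have "span (range (S {})) = UNIV"
    using linear_span_image[OF linear_flatten] span surj_flatten by metis
  then have "det (\<chi> k. S {} k) \<noteq> 0" by (rule det_nonzero_if_span_rows)
  moreover have "det (\<chi> k. S {} k) \<in> \<int>"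
    using int by (intro det_Ints) (auto simp: S_def integral_vec_def flatten_def split:
        option.split)
  ultimately have "1 \<le> \<bar>det (\<chi> k. S UNIV k)\<bar>"
    unfolding eq by (intro Ints_nonzero_abs_ge1)
  also have "\<dots> \<le> fact (CARD(4 option)) * (\<bar>(\<chi> k. S UNIV k) $ None $ None\<bar> *
      (\<Prod>j\<in>UNIV. infnorm (err_vec \<Theta> (u j - p j))))"
  proof (rule det_option_bound)
    show "(\<chi> k. S UNIV k) $ Some i $ None = 0" for i
      by (simp add: S_def fst_p)
    show "\<bar>(\<chi> k. S UNIV k) $ Some i $ Some j\<bar> \<le> infnorm (err_vec \<Theta> (u i - p i))" for i j
      using component_le_infnorm_cart[of "err_vec \<Theta> (u i - p i)" j]
      by (simp add: S_def err_vec_def fst_p)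
  qed
  also have "fact (CARD(4 option)) = (120::real)" by (simp add: fact_numeral)
  finally show ?thesis by (simp add: S_def)
qed

section \<open>Estimates for a single admissible tuple\<close>

context independent_point
begin

lemma reduced_err_le:
  "infnorm (err_vec \<Theta> (z i - (real (X i) / real (X j)) *\<^sub>R z j))
      \<le> L i + real (X i) / real (X j) * L j"
proof -
  have "infnorm (err_vec \<Theta> (z i) + - ((real (X i) / real (X j)) *\<^sub>R err_vec \<Theta> (z j)))
      \<le> L i + real (X i) / real (X j) * L j"
    using infnorm_triangle[of "err_vec \<Theta> (z i)" "- ((real (X i) / real (X j)) *\<^sub>R err_vec \<Theta> (z j))"]
    by (simp add: infnorm_neg infnorm_mul approx_err_best_q)
  then show ?thesis by (simp add: err_vec_diff err_vec_scaleR)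
qed

text \<open>The order of the indices decides which term of \<open>reduced_err_le\<close> dominates:
  for \<open>i < j\<close> it is the error \<open>L i\<close>, in the opposite case the scaled error
  of \<open>z j\<close>.\<close>

lemma reduced_err_le_before:
  assumes "i < j"
  shows "infnorm (err_vec \<Theta> (z i - (real (X i) / real (X j)) *\<^sub>R z j)) \<le> 2 * L i"
proof -
  have "real (X i) / real (X j) * L j \<le> 1 * L i"
    using X_less[OF assms] L_less[OF assms] X_pos[of j]
    by (intro mult_mono) (auto simp: approx_err_nonneg)
  then show ?thesis using reduced_err_le[of i j] by linarith
qed

lemma reduced_err_le_after:
  assumes "j < i"
  shows "infnorm (err_vec \<Theta> (z i - (real (X i) / real (X j)) *\<^sub>R z j))
      \<le> 2 * (real (X i) * L j / real (X j))"
proof -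
  define t where "t = real (X i) / real (X j) * L j"
  have "1 * L i \<le> t"
    unfolding t_def using X_less[OF assms] L_less[OF assms] X_pos[of j]
    by (intro mult_mono) (auto simp: approx_err_nonneg)
  then have "infnorm (err_vec \<Theta> (z i - (real (X i) / real (X j)) *\<^sub>R z j)) \<le> 2 * t"
    using reduced_err_le[of i j] unfolding t_def[symmetric] by linarith
  then show ?thesis by (simp add: t_def)
qed

lemma admissible_tuple_estimates:
  assumes adm: "admissible_tuple \<Theta> n r" and n: "1 \<le> n"
  defines "\<nu> \<equiv> r 0" and "s \<equiv> r 1" and "k \<equiv> r (n + 1)"
  shows "1 \<le> \<nu>" "\<nu> < s" "s < k"
    and "real (X s) * L (s - 1) \<le> 4 * (real (X (\<nu> + 1)) * L \<nu>)"
    and "1 \<le> 1920 * (real (X (s + 1)) * (L (s - 1) * L s * L (\<nu> - 1) * (real (X (k + 1)) * L k /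
        real (X k))))"
proof -
  have mono: "r i < r (i + 1)" if "i \<le> n" for i
    using adm that unfolding admissible_tuple_def Let_def by blast
  show \<nu>: "1 \<le> \<nu>" using adm unfolding admissible_tuple_def Let_def \<nu>_def by blast
  show \<nu>s: "\<nu> < s" using mono[of 0] by (simp add: \<nu>_def s_def)
  have "r 1 < r (1 + m)" if "1 \<le> m" "m \<le> n" for m
    using that
  proof (induction m rule: dec_induct)
    case base
    then show ?case using mono[of 1] by simp
  next
    case (step m)
    then show ?case using mono[of "1 + m"] by simp
  qed
  from this[of n] show sk: "s < k" using n by (simp add: s_def k_def)
  \<comment> \<open>The plane is recorded by the first and the last pair of each block; blocks
    \<open>0\<close> and \<open>n\<close> will place \<open>z\<close> at \<nu> and at
    \<open>k\<close> in \<open>T\<close>.\<close>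
  have plane: "span {z (r i), z (r i + 1)} = span {z (r (i + 1) - 1), z (r (i + 1))}" if i: "i
      \<le> n" for i
  proof -
    have "\<exists>S. subspace S \<and> dim S = 2 \<and>
          (\<forall>m. r i \<le> m \<and> m \<le> r (i + 1) - 1 \<longrightarrow> span {z m, z (m + 1)} = S)"
      using adm i unfolding admissible_tuple_def Let_def by blast
    then obtain S where S: "\<And>m. r i \<le> m \<and> m \<le> r (i + 1) - 1 \<Longrightarrow> span {z m, z (m + 1)} = S"
      by blast
    show ?thesis using S[of "r i"] S[of "r (i + 1) - 1"] mono[OF i] by simp
  qed
  have "\<exists>T. subspace T \<and> dim T = 3 \<and>
      (\<forall>i. 1 \<le> i \<and> i \<le> n \<longrightarrow> T = span {z (r i - 1), z (r i), z (r i + 1)}) \<and>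
      z (r 0 - 1) \<notin> T \<and> z (r (n + 1) + 1) \<notin> T"
    using adm unfolding admissible_tuple_def Let_def by (elim conjE)
  then obtain T where "\<forall>i. 1 \<le> i \<and> i \<le> n \<longrightarrow> T = span {z (r i - 1), z (r i), z (r i + 1)}"
    by (elim exE conjE)
  then have T: "T = span {z (r i - 1), z (r i), z (r i + 1)}" if "1 \<le> i" "i \<le> n" for i
    using that by (metis (no_types))
  have Ts: "T = span {z (s - 1), z s, z (s + 1)}" using T[of 1] n by (simp add: s_def)
  have Tn: "T = span {z (r n - 1), z (r n), z (r n + 1)}" using T[of n] n by simp
  have plane0: "span {z \<nu>, z (\<nu> + 1)} = span {z (s - 1), z s}"
    using plane[of 0] by (simp add: \<nu>_def s_def)
  have planen: "span {z (r n), z (r n + 1)} = span {z (k - 1), z k}"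
    using plane[of n] by (simp add: k_def)
  have mem0: "z \<nu> \<in> span {z (s - 1), z s}" "z (\<nu> + 1) \<in> span {z (s - 1), z s}"
    using plane0 by (metis insertCI span_base)+
  then show "real (X s) * L (s - 1) \<le> 4 * (real (X (\<nu> + 1)) * L \<nu>)"
    using same_plane_covolume[of \<nu> "s - 1"] \<nu>s by simp
  have \<nu>T: "z \<nu> \<in> T"
    using mem0(1) span_mono[of "{z (s - 1), z s}" "{z (s - 1), z s, z (s + 1)}"] unfolding Ts
        by auto
  have kT: "z (k - 1) \<in> T" "z k \<in> T"
  proof -
    have "span {z (k - 1), z k} \<subseteq> T"
      unfolding planen[symmetric] Tn by (rule span_mono) auto
    then show "z (k - 1) \<in> T" "z k \<in> T" by (auto intro: span_base)
  qed
  define u :: "4 \<Rightarrow> real \<times> (real^4)" where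
    "u j = (if j = 1 then z (s - 1) else if j = 2 then z s else if j
        = 3 then z (\<nu> - 1) else z (k + 1))" for j
  \<comment> \<open>Rows \<open>s - 1\<close> and \<open>s\<close> are reduced by
    \<open>z (s + 1)\<close>, the row kept as pivot; the two vectors outside \<open>T\<close> are
    reduced by their neighbours inside \<open>T\<close>.\<close>
  define p :: "4 \<Rightarrow> real \<times> (real^4)" where
    "p j = (if j = 1 then (real (X (s - 1)) / real (X (s + 1))) *\<^sub>R z (s + 1)
      else if j = 2 then (real (X s) / real (X (s + 1))) *\<^sub>R z (s + 1)
      else if j = 3 then (real (X (\<nu> - 1)) / real (X \<nu>)) *\<^sub>R z \<nu>
      else (real (X (k + 1)) / real (X k)) *\<^sub>R z k)" for j
  have u: "u 1 = z (s - 1)" "u 2 = z s" "u 3 = z (\<nu> - 1)" "u 4 = z (k + 1)"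
    by (simp_all add: u_def)
  have p: "p 1 = (real (X (s - 1)) / real (X (s + 1))) *\<^sub>R z (s + 1)"
    "p 2 = (real (X s) / real (X (s + 1))) *\<^sub>R z (s + 1)"
    "p 3 = (real (X (\<nu> - 1)) / real (X \<nu>)) *\<^sub>R z \<nu>"
    "p 4 = (real (X (k + 1)) / real (X k)) *\<^sub>R z k"
    by (simp_all add: p_def)
  have T': "T = span {z (s + 1), u 1, u 2}"
    unfolding Ts u by (simp add: insert_commute)
  have ind: "lin_indep_tuple [z (\<nu> - 1), z (r n - 1), z (k - 1), z k, z (k + 1)]"
    using adm unfolding admissible_tuple_def Let_def \<nu>_def k_def by blast
  \<comment> \<open>The assumed independence involves \<open>r n - 1\<close>, \<open>k - 1\<close>
    and \<open>k\<close> instead of \<open>s - 1\<close>, \<open>s\<close> and \<open>s + 1\<close>.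
    Those three vectors lie in \<open>T\<close>, so the rows of the determinant span
    \<open>V\<close> and hence everything.\<close>
  define V where "V = {z (\<nu> - 1), z (r n - 1), z (k - 1), z k, z (k + 1)}"
  have V: "independent V" "card V = 5"
    using ind by (simp_all add: lin_indep_tuple_def V_def)
  have "UNIV \<subseteq> span V"
    using V by (intro card_ge_dim_independent) simp_all
  also have "\<dots> \<subseteq> span (insert (z (s + 1)) (range u))"
  proof (rule span_minimal)
    have "T \<subseteq> span (insert (z (s + 1)) (range u))"
      unfolding T' by (intro span_mono) auto
    moreover have "z (r n - 1) \<in> T" unfolding Tn by (rule span_base) simp
    moreover have "z (\<nu> - 1) \<in> span (insert (z (s + 1)) (range u))"
      "z (k + 1) \<in> span (insert (z (s + 1)) (range u))"
      unfolding u[symmetric] by (auto intro: span_base)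
    ultimately show "V \<subseteq> span (insert (z (s + 1)) (range u))"
      using kT by (auto simp: V_def)
  qed simp
  finally have full: "span (insert (z (s + 1)) (range u)) = UNIV" by blast
  have "1 \<le> 120 * (\<bar>fst (z (s + 1))\<bar> * (\<Prod>j\<in>UNIV. infnorm (err_vec \<Theta> (u j - p j))))"
  proof (rule integral_det_estimate)
    show "fst (p j) = fst (u j)" for j
      using X_pos[of "s + 1"] X_pos[of \<nu>] X_pos[of k] by (simp add: p_def u_def fst_best_z)
    show "p 3 \<in> span {z (s + 1), u 1, u 2}" "p 4 \<in> span {z (s + 1), u 1, u 2}"
      unfolding T'[symmetric] p using \<nu>T kT by (simp_all add: Ts span_scale)
    show "p 1 \<in> span {z (s + 1)}" "p 2 \<in> span {z (s + 1)}"
      unfolding p by (auto intro: span_scale span_base)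
    show "integral_vec (u j)" for j by (simp add: u_def integral_vec_best_z)
  qed (use full in \<open>simp_all add: integral_vec_best_z\<close>)
  also have "(\<Prod>j\<in>UNIV. infnorm (err_vec \<Theta> (u j - p j))) =
      infnorm (err_vec \<Theta> (u 1 - p 1)) * infnorm (err_vec \<Theta> (u 2 - p 2)) *
      infnorm (err_vec \<Theta> (u 3 - p 3)) * infnorm (err_vec \<Theta> (u 4 - p 4))"
    unfolding UNIV_4 by (simp add: mult.assoc)
  \<comment> \<open>Each of the four reduced errors costs a factor \<open>2\<close>, and
    \<open>120 * 2^4 = 1920\<close>.\<close>
  also have "120 * (\<bar>fst (z (s + 1))\<bar> * \<dots>) \<le> 120 * (\<bar>fst (z (s + 1))\<bar> *
      ((2 * L (s - 1)) * (2 * L s) * (2 * L (\<nu> - 1)) * (2 * (real (X (k + 1)) * L k / real (X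
          k)))))"
    unfolding u p using \<nu> \<nu>s
    by (intro mult_left_mono mult_mono reduced_err_le_before reduced_err_le_after
        mult_nonneg_nonneg infnorm_pos_le approx_err_nonneg) auto
  also have "\<dots> = 1920 * (real (X (s + 1)) *
      (L (s - 1) * L s * L (\<nu> - 1) * (real (X (k + 1)) * L k / real (X k))))"
    by (simp add: fst_best_z)
  finally show "1 \<le> 1920 * (real (X (s + 1)) *
      (L (s - 1) * L s * L (\<nu> - 1) * (real (X (k + 1)) * L k / real (X k))))" .
qed

end

section \<open>Exponents\<close>

lemma finite_denoms: "finite {q::nat. 0 < q \<and> real q \<le> t}"
proof (rule finite_subset)
  show "{q::nat. 0 < q \<and> real q \<le> t} \<subseteq> {..nat \<lfloor>t\<rfloor>}"
    by (auto simp: le_nat_floor)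
qed simp

lemma psi_le: "0 < q \<Longrightarrow> real q \<le> t \<Longrightarrow> psi \<Theta> t \<le> approx_err \<Theta> q"
  unfolding psi_def using finite_denoms by (intro Min_le) auto

lemma psi_attained:
  assumes "1 \<le> t"
  obtains q where "0 < q" "real q \<le> t" "psi \<Theta> t = approx_err \<Theta> q"
proof -
  have "psi \<Theta> t \<in> approx_err \<Theta> ` {q. 0 < q \<and> real q \<le> t}"
    unfolding psi_def using finite_denoms assms by (intro Min_in) (auto intro!: exI[of _ 1])
  then show ?thesis using that by auto
qed

text \<open>Apply Dirichlet's theorem with \<open>N\<close> the integer part of
  \<open>t powr (1/4)\<close>, which is less than \<open>2 * N\<close>.\<close>

lemma omega_hat_ge: "ereal (1/4) \<le> omega_hat \<Theta>"
proof -
  have bound: "t powr (1/4) * psi \<Theta> t \<le> 2" if t: "1 \<le> t" for t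
  proof -
    define N where "N = nat \<lfloor>t powr (1/4)\<rfloor>"
    have tp: "1 \<le> t powr (1/4)" using t by (simp add: ge_one_powr_ge_zero)
    then have N: "0 < N" "real N \<le> t powr (1/4)" "t powr (1/4) < real N + 1"
      unfolding N_def by linarith+
    obtain q where q: "0 < q" "q \<le> N^4" "approx_err \<Theta> q \<le> 1 / real N"
      using Dirichlet_approx_err[OF N(1)] by metis
    have "real q \<le> real N ^ 4" using q(2) by (metis of_nat_le_iff of_nat_power)
    also have "\<dots> \<le> (t powr (1/4)) ^ 4" using N by (intro power_mono) auto
    also have "\<dots> = t" using t by (simp add: powr_power)
    finally have "psi \<Theta> t \<le> 1 / real N" using psi_le[of q t \<Theta>] q by linarith
    then have "t powr (1/4) * psi \<Theta> t \<le> t powr (1/4) * (1 / real N)"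
      by (intro mult_left_mono) auto
    also have "\<dots> \<le> (2 * real N) * (1 / real N)"
      using N by (intro mult_right_mono) auto
    also have "\<dots> = 2" using N by simp
    finally show ?thesis .
  qed
  have "Limsup at_top (\<lambda>t::real. ereal (t powr (1/4) * psi \<Theta> t)) \<le> ereal 2"
    by (rule Limsup_bounded) (use bound in \<open>auto intro!: eventually_mono[OF
        eventually_ge_at_top[of 1]]\<close>)
  then have "Limsup at_top (\<lambda>t::real. ereal (t powr (1/4) * psi \<Theta> t)) < \<infinity>"
    using le_less_trans by fastforce
  then show ?thesis
    unfolding omega_hat_def by (intro Sup_upper) auto
qed

section \<open>Logarithmic inequalities from the two exponents\<close>

context independent_point
begin

abbreviation "x m \<equiv> ln (real (X m))"
abbreviation "l m \<equiv> - ln (L m)"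

lemma x_mono: "m \<le> n \<Longrightarrow> x m \<le> x n"
  using X_le[of m n] X_pos[of m] by (simp add: X_pos)

text \<open>For \<open>t\<close> below the next denominator, \<open>psi\<close> is at least
  \<open>L m\<close>. The point \<open>t = X (Suc m) / 2\<close> qualifies, and the factor
  \<open>1/2\<close> only affects the constant \<open>C\<close>.\<close>

lemma uniform_lower:
  assumes w: "ereal w < omega_hat \<Theta>"
  shows "\<exists>C. eventually (\<lambda>m. w * x (Suc m) - C \<le> l m) sequentially"
proof -
  obtain \<gamma> where \<gamma>: "w < \<gamma>" "Limsup at_top (\<lambda>t::real. ereal (t powr \<gamma> * psi \<Theta> t)) < \<infinity>"
    using w unfolding omega_hat_def less_Sup_iff by auto
  obtain K where K: "Limsup at_top (\<lambda>t::real. ereal (t powr \<gamma> * psi \<Theta> t)) < ereal K"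
    using \<gamma>(2) less_PInf_Ex_of_nat by (metis ereal_dense2)
  have ev: "eventually (\<lambda>t::real. t powr \<gamma> * psi \<Theta> t < K) at_top"
    using Limsup_lessD[OF K] by simp
  have lim: "filterlim (\<lambda>m. real (X (Suc m)) / 2) at_top sequentially"
  proof (rule filterlim_at_top_mono)
    show "filterlim (\<lambda>m. real m / 2) at_top sequentially"
      using filterlim_tendsto_pos_mult_at_top[OF tendsto_const _ filterlim_real_sequentially, of
          "1/2"]
      by simp
    show "eventually (\<lambda>m. real m / 2 \<le> real (X (Suc m)) / 2) sequentially"
    proof (rule always_eventually, rule allI)
      show "real m / 2 \<le> real (X (Suc m)) / 2" for m using X_ge[of "Suc m"] by simp
    qed
  qed
  have "eventually (\<lambda>m. w * x (Suc m) - (w * ln 2 + ln K) \<le> l m) sequentially"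
    using eventually_compose_filterlim[OF ev lim] eventually_ge_at_top[of 1]
  proof eventually_elim
    case (elim m)
    define t where "t = real (X (Suc m)) / 2"
    have t: "1 \<le> t" using X_ge[of "Suc m"] elim(2) by (simp add: t_def)
    obtain q where q: "0 < q" "real q \<le> t" "psi \<Theta> t = approx_err \<Theta> q"
      using psi_attained[OF t] by metis
    have "real q < real (X (Suc m))" using q(2) X_pos[of "Suc m"] unfolding t_def by simp
    then have "L m \<le> psi \<Theta> t" using L_le_approx_err[of q m] q by simp
    then have "t powr \<gamma> * L m \<le> t powr \<gamma> * psi \<Theta> t" by (intro mult_left_mono) auto
    moreover have "t powr w * L m \<le> t powr \<gamma> * L m"
      using \<gamma>(1) t by (intro mult_right_mono approx_err_nonneg powr_mono) auto
    ultimately have le: "t powr w * L m \<le> K" using elim(1) unfolding t_def by linarith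
    have "0 < t powr w * L m" using t L_pos[of m] by simp
    then have "ln (t powr w * L m) \<le> ln K" using le by (simp add: ln_le_cancel_iff)
    moreover have "ln (t powr w * L m) = w * (x (Suc m) - ln 2) + ln (L m)"
      using t L_pos[of m] X_pos[of "Suc m"] by (simp add: ln_mult ln_powr t_def ln_div)
    ultimately show ?case by (simp add: algebra_simps)
  qed
  then show ?thesis by blast
qed

text \<open>An exponent above the supremum has infinite lower limit, so the product eventually
  exceeds \<open>1\<close>; evaluate it at \<open>t = X m\<close>.\<close>

lemma ordinary_upper:
  assumes \<gamma>: "omega \<Theta> < ereal \<gamma>"
  shows "eventually (\<lambda>m. l m \<le> \<gamma> * x m) sequentially"
proof -
  have "\<not> Liminf at_top (\<lambda>t::real. ereal (t powr \<gamma> * psi \<Theta> t)) < \<infinity>"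
  proof
    assume "Liminf at_top (\<lambda>t::real. ereal (t powr \<gamma> * psi \<Theta> t)) < \<infinity>"
    then have "ereal \<gamma> \<le> omega \<Theta>" unfolding omega_def by (intro Sup_upper) auto
    then show False using \<gamma> by simp
  qed
  then have "ereal 1 < Liminf at_top (\<lambda>t::real. ereal (t powr \<gamma> * psi \<Theta> t))"
    by (simp add: not_less)
  then have ev: "eventually (\<lambda>t::real. 1 < t powr \<gamma> * psi \<Theta> t) at_top"
    using less_LiminfD by fastforce
  have lim: "filterlim (\<lambda>m. real (X m)) at_top sequentially"
    by (rule filterlim_at_top_mono[OF filterlim_real_sequentially]) (simp add: X_ge)
  show ?thesis
    using eventually_compose_filterlim[OF ev lim]
  proof eventually_elim
    case (elim m)
    have "real (X m) powr \<gamma> * psi \<Theta> (real (X m)) \<le> real (X m) powr \<gamma> * L m"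
      by (intro mult_left_mono psi_le X_pos) auto
    then have "ln 1 < ln (real (X m) powr \<gamma> * L m)"
      using elim by (intro ln_less_cancel_iff[THEN iffD2]) auto
    moreover have "ln (real (X m) powr \<gamma> * L m) = \<gamma> * x m + ln (L m)"
      using L_pos[of m] X_pos[of m] by (simp add: ln_mult ln_powr)
    ultimately show ?case by simp
  qed
qed

end

text \<open>In the application \<open>y0, y1, Y\<close> are the logarithms of the denominators at
  \<nu>, \<open>s\<close>, \<open>k\<close>, and \<open>A0\<close>, \<open>A1\<close> those of
  \<open>X s * L (s - 1)\<close> and \<open>X (s + 1) * L s\<close>. The assumptions
  \<open>cG\<close> say that the weights below are at most \<open>1\<close>.\<close>

lemma exponent_elimination:
  fixes w G K A0 A1 y0 y1 Y :: real
  assumes w: "0 < w" "w < 1" and G: "0 < G"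
    and cG: "w \<le> (1 - w) * G" "w * (G + 1) \<le> (1 - w) * G^2"
    and A0: "A0 \<le> (1 - w) * y1 + K" "A0 \<le> (1 - w) * G * y0 + K"
    and A1: "A1 \<le> (1 - w) * Y + K" "A1 \<le> (1 - w) * G * y1 + K"
  shows "A0 + A1 - y1 - w * y0 \<le> 2 * K + (1 - w - w / G - w / G^2) * Y"
proof -
  txt \<open>The weights \<open>a\<close> and \<open>b\<close> of the convex combinations cancel \<open>y0\<close> and \<open>y1\<close>, respectively.\<close>
  define a where "a = w / ((1 - w) * G)"
  define b where "b = w * (G + 1) / ((1 - w) * G^2)"
  have a: "0 \<le> a" "a \<le> 1" using w G cG by (simp_all add: a_def)
  have b: "0 \<le> b" "b \<le> 1" using w G cG by (simp_all add: b_def)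
  have "A0 = (1 - a) * A0 + a * A0" by (simp add: algebra_simps)
  also have "\<dots> \<le> (1 - a) * ((1 - w) * y1 + K) + a * ((1 - w) * G * y0 + K)"
    using a A0 by (intro add_mono mult_left_mono) auto
  also have "\<dots> = (1 - w - w / G) * y1 + w * y0 + K"
  proof -
    have "a * (1 - w) = w / G" "a * ((1 - w) * G) = w" using w G by (simp_all add: a_def)
    then show ?thesis by algebra
  qed
  finally have 1: "A0 \<le> (1 - w - w / G) * y1 + w * y0 + K" .
  have "A1 = (1 - b) * A1 + b * A1" by (simp add: algebra_simps)
  also have "\<dots> \<le> (1 - b) * ((1 - w) * Y + K) + b * ((1 - w) * G * y1 + K)"
    using b A1 by (intro add_mono mult_left_mono) auto
  also have "\<dots> = (1 - w - w / G - w / G^2) * Y + (w + w / G) * y1 + K"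
  proof -
    have "b * (1 - w) = w / G + w / G^2" "b * ((1 - w) * G) = w + w / G"
      using w G by (simp_all add: b_def field_simps power2_eq_square)
    then show ?thesis by algebra
  qed
  finally show ?thesis using 1 by (simp add: algebra_simps)
qed

context independent_point
begin

lemma admissible_tuples_contradiction:
  assumes n: "1 \<le> n" and lim: "filterlim (\<lambda>i. r i 0) at_top sequentially"
    and adm: "\<And>i. admissible_tuple \<Theta> n (r i)"
    and w: "0 < w" "w < 1" "ereal w < omega_hat \<Theta>" and G: "0 < G" "omega \<Theta> < ereal (w * G)"
    and cG: "w \<le> (1 - w) * G" "w * (G + 1) \<le> (1 - w) * G^2"
    and neg: "(1 - w) * G^3 < w * (G^2 + G + 1)"
  shows False
proof -
  obtain C where C: "eventually (\<lambda>m. w * x (Suc m) - C \<le> l m) sequentially"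
    using uniform_lower[OF w(3)] by blast
  obtain M where M: "\<And>m. M \<le> m \<Longrightarrow> w * x (Suc m) - C \<le> l m \<and> l m \<le> w * G * x m"
    using eventually_conj[OF C ordinary_upper[OF G(2)]] unfolding eventually_sequentially by blast
  \<comment> \<open>Dividing by \<open>w\<close> makes the growth bound read
    \<open>G * x m + D\<close>; the maximum keeps \<open>D\<close> nonnegative.\<close>
  define D where "D = max 0 C / w"
  have D: "0 \<le> D" "w * D \<ge> C" "w * D \<ge> 0" using w by (simp_all add: D_def)
  have grow: "x (Suc m) \<le> G * x m + D" if "M \<le> m" for m
  proof -
    have "w * x (Suc m) \<le> w * (G * x m + D)" using M[OF that] D by (simp add: algebra_simps)
    then show ?thesis using w by simp
  qed
  have low: "w * x (Suc m) - w * D \<le> l m" if "M \<le> m" for m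
    using M[OF that] D by linarith
  \<comment> \<open>Minus the total coefficient of \<open>x k\<close> after elimination; it is
    positive precisely because of \<open>neg\<close>.\<close>
  define \<delta> where "\<delta> = w + w / G + w / G^2 - (1 - w) * G"
  have \<delta>: "0 < \<delta>"
  proof -
    have "\<delta> * G^2 = w * (G^2 + G + 1) - (1 - w) * G^3"
      using G by (simp add: \<delta>_def field_simps power2_eq_square power3_eq_cube)
    then have "0 < \<delta> * G^2" using neg by linarith
    then show ?thesis using G by (simp add: zero_less_mult_iff)
  qed
  define K where "K = ln 4 + D"
  define B where "B = ln 1920 + 2 * K + 2 * D"
  have bound: "\<delta> * x (r i (n + 1)) \<le> B" if i: "M + 1 \<le> r i 0" for i
  proof -
    define \<nu> s k where "\<nu> = r i 0" and "s = r i 1" and "k = r i (n + 1)"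
    note est = admissible_tuple_estimates[OF adm[of i] n, folded \<nu>_def s_def k_def]
    have \<nu>: "M \<le> \<nu> - 1" "M \<le> \<nu>" "M \<le> s - 1" "M \<le> s" "M \<le> k" "1 \<le> \<nu>" "1 \<le> s"
      using i est(1,2,3) by (auto simp: \<nu>_def)
    have Xp: "0 < real (X m)" for m using X_pos by simp
    have wD: "w * D \<le> D" using w D by (simp add: mult_left_le_one_le)
    have "ln (real (X s) * L (s - 1)) \<le> ln (4 * (real (X (\<nu> + 1)) * L \<nu>))"
      using est(4) by (intro ln_mono) (auto intro!: mult_pos_pos X_pos L_pos)
    then have plane: "x s - l (s - 1) \<le> ln 4 + x (\<nu> + 1) - l \<nu>"
      using Xp[of s] Xp[of "\<nu> + 1"] L_pos[of "s - 1"] L_pos[of \<nu>] by (simp add: ln_mult)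
    have "ln 1 \<le> ln (1920 * (real (X (s + 1)) *
        (L (s - 1) * L s * L (\<nu> - 1) * (real (X (k + 1)) * L k / real (X k)))))"
      using est(5) by (intro ln_mono) auto
    then have main: "0 \<le> ln 1920 + x (s + 1) - l (s - 1) - l s - l (\<nu> - 1) + x (k + 1) - l k - x k"
      using Xp[of "s + 1"] Xp[of "k + 1"] Xp[of k] L_pos[of "s - 1"] L_pos[of s] L_pos[of "\<nu> - 1"]
          L_pos[of k]
      by (simp add: ln_mult ln_div)
    have grow': "(1 - w) * x (m + 1) + w * D \<le> (1 - w) * G * x m + D" if "M \<le> m" for m
    proof -
      have "(1 - w) * x (m + 1) \<le> (1 - w) * (G * x m + D)"
        using grow[OF that] w by (intro mult_left_mono) auto
      then show ?thesis by (simp add: algebra_simps)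
    qed
    have diff: "x (m + 1) - l m \<le> (1 - w) * x (m + 1) + w * D" if "M \<le> m" for m
      using low[OF that] by (simp add: algebra_simps)
    have l4: "0 \<le> ln (4::real)" by simp
    have A0: "x s - l (s - 1) \<le> (1 - w) * x s + K"
    proof -
      have "s - 1 + 1 = s" using \<nu> by simp
      then have "x s - l (s - 1) \<le> (1 - w) * x s + w * D" using diff[OF \<nu>(3)] by (simp only:)
      then show ?thesis using wD l4 unfolding K_def by linarith
    qed
    \<comment> \<open>The covolume comparison moves the estimate from \<open>s\<close> back to
      \<nu>.\<close>
    have A0': "x s - l (s - 1) \<le> (1 - w) * G * x \<nu> + K"
      using plane diff[of \<nu>] grow'[of \<nu>] \<nu> unfolding K_def by linarith
    \<comment> \<open>Only \<open>s + 1 \<le> k\<close> is known, which suffices because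
      \<open>x\<close> is monotone.\<close>
    have "(1 - w) * x (s + 1) \<le> (1 - w) * x k"
      using est(3) w by (intro mult_left_mono x_mono) auto
    then have A1: "x (s + 1) - l s \<le> (1 - w) * x k + K"
      using diff[of s] \<nu> wD l4 unfolding K_def by linarith
    have A1': "x (s + 1) - l s \<le> (1 - w) * G * x s + K"
      using diff[of s] grow'[of s] \<nu> l4 unfolding K_def by linarith
    have "(x s - l (s - 1)) + (x (s + 1) - l s) - x s - w * x \<nu>
        \<le> 2 * K + (1 - w - w / G - w / G^2) * x k"
      by (rule exponent_elimination[OF w(1,2) G(1) cG A0 A0' A1 A1'])
    moreover have "w * x \<nu> - w * D \<le> l (\<nu> - 1)" using low[of "\<nu> - 1"] \<nu> by simp
    moreover have "x (k + 1) - l k \<le> (1 - w) * G * x k + D"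
      using diff[of k] grow'[of k] \<nu> by simp
    moreover have "(1 - w - w / G - w / G^2) * x k + (1 - w) * G * x k - x k = - (\<delta> * x k)"
      by (simp add: \<delta>_def algebra_simps)
    ultimately show ?thesis using main wD unfolding B_def k_def[symmetric] by linarith
  qed
  \<comment> \<open>Since \<open>k\<close> exceeds the first index, \<open>x k\<close> is unbounded
    along the sequence. The summand \<open>1\<close> makes the product exceed \<open>B\<close>
    strictly.\<close>
  have "eventually (\<lambda>i. M + 1 \<le> r i 0 \<and> nat \<lceil>exp (B / \<delta> + 1)\<rceil> \<le> r i 0) sequentially"
    using lim unfolding filterlim_at_top by (intro eventually_conj) blast+
  then obtain i where i: "M + 1 \<le> r i 0" "nat \<lceil>exp (B / \<delta> + 1)\<rceil> \<le> r i 0"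
    unfolding eventually_sequentially by blast
  have "r i 0 < r i (n + 1)" using admissible_tuple_estimates(2,3)[OF adm[of i] n] by linarith
  then have "nat \<lceil>exp (B / \<delta> + 1)\<rceil> \<le> X (r i (n + 1))" using i X_ge[of "r i (n + 1)"] by linarith
  then have "exp (B / \<delta> + 1) \<le> real (X (r i (n + 1)))" by linarith
  then have "B / \<delta> + 1 \<le> x (r i (n + 1))" using X_pos by (simp add: ln_ge_iff)
  then have "\<delta> * (B / \<delta> + 1) \<le> \<delta> * x (r i (n + 1))" using \<delta> by (intro mult_left_mono) auto
  then show False using bound[OF i(1)] \<delta> by (simp add: distrib_left)
qed

text \<open>If the bound failed, there would be room to lower both \<open>G1 W\<close> and
  \<open>W\<close> slightly: the cubic inequality then fails strictly while \<open>w * G\<close>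
  still exceeds the ordinary exponent.\<close>

lemma omega_ge_G1:
  assumes n: "1 \<le> n" and lim: "filterlim (\<lambda>i. r i 0) at_top sequentially"
    and adm: "\<And>i. admissible_tuple \<Theta> n (r i)"
    and W: "omega_hat \<Theta> = ereal W" "1/4 \<le> W" "W < 1"
  shows "ereal (W * G1 W) \<le> omega \<Theta>"
proof (rule ccontr)
  assume "\<not> ?thesis"
  then have less: "omega \<Theta> < ereal (W * G1 W)" by simp
  define g where "g = G1 W"
  define c where "c = W / (1 - W)"
  obtain t where t: "omega \<Theta> < ereal t" "t < W * g"
    using ereal_dense2[OF less] unfolding g_def by auto
  have c: "0 < c" using W by (simp add: c_def)
  have g: "0 < g" "g^3 = c * (g^2 + g + 1)" "c < g"
    using G1_root[of W] G1_ge[of W] W by (auto simp: g_def c_def)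
  have g2: "c * (g + 1) < g^2"
  proof -
    have "g * (g^2 - c * (g + 1)) = c" using g(2) by algebra
    then have "0 < g * (g^2 - c * (g + 1))" using c by simp
    then show ?thesis using g(1) by (simp add: zero_less_mult_iff)
  qed
  \<comment> \<open>For fixed \<open>a\<close> the inequality weakens as \<open>w\<close> decreases,
    so it can be checked at \<open>W\<close>.\<close>
  have ge_cW: "w \<le> (1 - w) * a" if "W \<le> (1 - W) * a" "0 < w" "w < W" "0 < a" for w a
  proof -
    have "(1 - W) * a \<le> (1 - w) * a" using that by (intro mult_right_mono) auto
    then show ?thesis using that by linarith
  qed
  \<comment> \<open>First \<open>G\<close> is chosen close below \<open>g\<close> with
    \<open>W\<close> fixed, and only then \<open>w\<close> close below \<open>W\<close>; the
    conditions imposed by continuity are strict at the limit.\<close>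
  have "eventually (\<lambda>G. t < W * G) (at_left g)"
    by (rule order_tendstoD(1)[of _ "W * g"]) (use t in \<open>auto intro!: tendsto_eq_intros\<close>)
  moreover have "eventually (\<lambda>G. c < G) (at_left g)"
    by (rule order_tendstoD(1)[of _ g]) (use g in \<open>auto intro!: tendsto_eq_intros\<close>)
  moreover have "eventually (\<lambda>G. 0 < G^2 - c * (G + 1)) (at_left g)"
    by (rule order_tendstoD(1)[of _ "g^2 - c * (g + 1)"]) (use g2 in \<open>auto intro!:
        tendsto_eq_intros\<close>)
  moreover have "eventually (\<lambda>G. G < g) (at_left g)"
    by (simp add: eventually_at_filter)
  ultimately have "eventually (\<lambda>G. t < W * G \<and> c < G \<and> 0 < G^2 - c * (G + 1) \<and> G < g) (at_left g)"
    by eventually_elim auto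
  then obtain G where G: "t < W * G" "c < G" "0 < G^2 - c * (G + 1)" "G < g"
    using eventually_happens' trivial_limit_at_left_real by blast
  have G0: "0 < G" using G c by linarith
  have "G^3 < c * (G^2 + G + 1)"
    using cubic_inequality_upward[OF c G0 G(4)] g(2) by linarith
  then have "(1 - W) * G^3 < (1 - W) * (c * (G^2 + G + 1))" using W by simp
  then have neg: "(1 - W) * G^3 < W * (G^2 + G + 1)" using W by (simp add: c_def)
  have "eventually (\<lambda>w. t < w * G) (at_left W)"
    by (rule order_tendstoD(1)[of _ "W * G"]) (use G in \<open>auto intro!: tendsto_eq_intros\<close>)
  moreover have "eventually (\<lambda>w. 0 < w) (at_left W)"
    by (rule order_tendstoD(1)[of _ W]) (use W in \<open>auto intro!: tendsto_eq_intros\<close>)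
  moreover have "eventually (\<lambda>w. 0 < w * (G^2 + G + 1) - (1 - w) * G^3) (at_left W)"
    by (rule order_tendstoD(1)[of _ "W * (G^2 + G + 1) - (1 - W) * G^3"])
      (use neg in \<open>auto intro!: tendsto_eq_intros\<close>)
  moreover have "eventually (\<lambda>w. w < W) (at_left W)"
    by (simp add: eventually_at_filter)
  ultimately have "eventually (\<lambda>w. t < w * G \<and> 0 < w \<and> 0 < w * (G^2 + G + 1) - (1 - w) * G^3 \<and> w <
      W) (at_left W)"
    by eventually_elim auto
  then obtain w where w: "t < w * G" "0 < w" "0 < w * (G^2 + G + 1) - (1 - w) * G^3" "w < W"
    using eventually_happens' trivial_limit_at_left_real by blast
  have "W \<le> (1 - W) * G" using G(2) W by (simp add: c_def field_simps)
  then have 1: "w \<le> (1 - w) * G" using ge_cW w G0 by blast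
  have "c \<le> G^2 / (G + 1)" using G(3) G0 by (simp add: field_simps)
  then have "W \<le> (1 - W) * (G^2 / (G + 1))" using W
      by (simp add: c_def pos_divide_le_eq mult.commute)
  then have "w \<le> (1 - w) * (G^2 / (G + 1))" by (rule ge_cW) (use w G0 in auto)
  then have 2: "w * (G + 1) \<le> (1 - w) * G^2" using G0 by (simp add: pos_le_divide_eq)
  have "omega \<Theta> < ereal (w * G)" using t(1) w(1) less_trans by (metis less_ereal.simps(1))
  then show False
    using admissible_tuples_contradiction[OF n lim adm w(2) _ _ G0 _ 1 2] w W by simp
qed

end

section \<open>From the index to the bounds\<close>

text \<open>A finite infimum excludes the empty set, and a nonempty set of extended naturals attains
  its infimum.\<close>

lemma approx_index_eqD:
  assumes "approx_index \<Theta> = enat n"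
  obtains r where "1 \<le> n" "filterlim (\<lambda>l. r l 0) at_top sequentially" "\<And>l. admissible_tuple \<Theta> n (r
      l)"
proof -
  define S where "S = {n. 1 \<le> n \<and> (\<exists>r::nat \<Rightarrow> nat \<Rightarrow> nat. filterlim (\<lambda>l. r l 0) at_top sequentially \<and>
        (\<forall>l. admissible_tuple \<Theta> n (r l)))}"
  have Inf: "Inf (enat ` S) = enat n" using assms unfolding approx_index_def S_def .
  then have "S \<noteq> {}" by (auto simp: top_enat_def)
  then have "Inf (enat ` S) \<in> enat ` S"
      by (intro wellorder_InfI[of "enat (SOME m. m \<in> S)"]) (simp add: some_in_eq)
  then have "n \<in> S" unfolding Inf by auto
  then show ?thesis using that unfolding S_def by blast
qed

theorem theorem1:
  fixes \<Theta> :: "real^4"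
  assumes "lin_indep_over_Z \<Theta>"
    and "omega_hat \<Theta> < 1"
  shows "(approx_index \<Theta> = 1 \<longrightarrow>
            omega \<Theta> \<ge> omega_hat \<Theta> * ereal (G1 (real_of_ereal (omega_hat \<Theta>)))) \<and>
         (approx_index \<Theta> = 2 \<longrightarrow>
            omega \<Theta> \<ge> omega_hat \<Theta> * ereal (G2 (real_of_ereal (omega_hat \<Theta>)))) \<and>
         (approx_index \<Theta> = 3 \<longrightarrow>
            omega \<Theta> \<ge> omega_hat \<Theta> * ereal (G3 (real_of_ereal (omega_hat \<Theta>))))"
proof -
  interpret independent_point \<Theta> by standard (rule assms(1))
  \<comment> \<open>Dirichlet's lower bound and the assumed upper bound make the uniform exponent a
    real number in \<open>[1/4, 1)\<close>.\<close>
  obtain W where W: "omega_hat \<Theta> = ereal W" "1/4 \<le> W" "W < 1"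
    using omega_hat_ge[of \<Theta>] assms(2) by (cases "omega_hat \<Theta>") auto
  have bound: "ereal (W * a) \<le> omega \<Theta>" if idx: "approx_index \<Theta> = enat n" and a: "a \<le> G1 W" for n a
  proof -
    obtain r where "1 \<le> n" "filterlim (\<lambda>l. r l 0) at_top sequentially" "\<And>l. admissible_tuple \<Theta> n
        (r l)"
      using approx_index_eqD[OF idx] by metis
    then have "ereal (W * G1 W) \<le> omega \<Theta>" using W by (rule omega_ge_G1)
    moreover have "W * a \<le> W * G1 W" using a W by (intro mult_left_mono) auto
    ultimately show ?thesis using order_trans by (metis ereal_less_eq(3))
  qed
  show ?thesis
    using bound[of 1 "G1 W"] bound[of 2 "G2 W"] bound[of 3 "G3 W"] G2_le_G1[OF W(2,3)] G3_le_G1[OF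
        W(2,3)]
    by (auto simp: W(1) one_enat_def numeral_eq_enat)
qed

end
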